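(* Let $n\geq 1$, let $\Omega\subset\mathbb{R}^n$ be a bounded domain with $C^{1,1}$ boundary, let $\Omega_e:=\mathbb{R}^n\setminus\overline{\Omega}$ and $s\in(0,1)$. Let $W_1,W_2\subset\Omega_e$ be two arbitrary nonempty open sets. Let $N\in\mathbb{N}$ be finite and, for $j=1,2$, let \[ \mathbf{a}_j(x,u)=\sum_{k=1}^N a_j^{(k)}(x)u^k,\qquad a_j^{(k)}\in C^s(\overline{\Omega}), \] and $F_j\in L^\infty(\Omega)$. Consider, for $j=1,2$ and exterior data $f$, \[ \begin{cases}(-\Delta)^s u_j+\mathbf{a}_j(x,u_j)=F_j & \text{in }\Omega,\\ u_j=f & \text{in }\Omega_e,\end{cases} \] and assume this problem is well-posed, i.e. for each exterior datum $f$ used below it has a unique solution $u_j\in C^s(\mathbb{R}^n)$. Let $f_0,f_1,\dots,f_N\in C^{2,s}(\Omega_e)$ with $\operatorname{supp}(f_k)\subset W_1$, $f_k|_{W_1}\in C^{2,s}(\overline{W_1})$, and such that for all $k\neq l$ in $\{0,\dots,N\}$ there exists $x\in W_1$ with $f_k(x)\neq f_l(x)$. If \[ \mathcal{C}^{W_1,W_2}_{\mathbf{a}_1,F_1}(f_k)=\mathcal{C}^{W_1,W_2}_{\mathbf{a}_2,F_2}(f_k),\qquad k=0,1,\dots,N, \] then $a_1^{(k)}=a_2^{(k)}$ in $\Omega$ for $k=1,\dots,N$, and $F_1=F_2$ in $\Omega$.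
   Context: The fractional Laplacian is $(-\Delta)^s u(x)=c_{n,s}\,\mathrm{P.V.}\int_{\mathbb{R}^n}\frac{u(x)-u(y)}{|x-y|^{n+2s}}\,dy$ with $c_{n,s}=\frac{\Gamma(\frac n2+s)}{|\Gamma(-s)|}\frac{4^s}{\pi^{n/2}}$. For the problem $(-\Delta)^s u+\mathbf{a}(x,u)=F$ in $\Omega$, $u=f$ in $\Omega_e$ with $\operatorname{supp} f\subset W_1$ and unique solution $u$, the Cauchy data is $\mathcal{C}^{W_1,W_2}_{\mathbf{a},F}(f):=\big(u|_{W_1},\,(-\Delta)^s u|_{W_2}\big)=\big(f|_{W_1},\,(-\Delta)^s u|_{W_2}\big)$. *)

theory Defs
  imports "HOL-Analysis.Analysis"
begin

definition frac_const :: "nat \<Rightarrow> real \<Rightarrow> real" where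
  "frac_const n s = Gamma (real n / 2 + s) / \<bar>Gamma (- s)\<bar> * 4 powr s / pi powr (real n / 2)"

definition frac_lap :: "real \<Rightarrow> ('a::euclidean_space \<Rightarrow> real) \<Rightarrow> 'a \<Rightarrow> real" where
  "frac_lap s u x = frac_const DIM('a) s *
     Lim (at_right 0) (\<lambda>\<epsilon>. \<integral>y. indicator {y. dist x y > \<epsilon>} y * (u x - u y)
                                    / dist x y powr (real DIM('a) + 2 * s) \<partial>lborel)"

definition frac_form :: "real \<Rightarrow> ('a::euclidean_space \<Rightarrow> real) \<Rightarrow> ('a \<Rightarrow> real) \<Rightarrow> real" where
  "frac_form s u \<phi> = frac_const DIM('a) s / 2 *
     (\<integral>p. (u (fst p) - u (snd p)) * (\<phi> (fst p) - \<phi> (snd p))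
            / dist (fst p) (snd p) powr (real DIM('a) + 2 * s) \<partial>(lborel \<Otimes>\<^sub>M lborel))"

definition holder_on :: "'a::metric_space set \<Rightarrow> real \<Rightarrow> ('a \<Rightarrow> real) \<Rightarrow> bool" where
  "holder_on S s f \<longleftrightarrow> continuous_on S f \<and> bounded (f ` S) \<and>
     (\<exists>C. \<forall>x\<in>S. \<forall>y\<in>S. \<bar>f x - f y\<bar> \<le> C * dist x y powr s)"

definition C2s_on :: "'a::euclidean_space set \<Rightarrow> real \<Rightarrow> ('a \<Rightarrow> real) \<Rightarrow> bool" where
  "C2s_on U s f \<longleftrightarrow> (\<exists>(f' :: 'a \<Rightarrow> 'a \<Rightarrow>\<^sub>L real) (f'' :: 'a \<Rightarrow> 'a \<Rightarrow>\<^sub>L ('a \<Rightarrow>\<^sub>L real)) B C.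
     (\<forall>x\<in>U. (f has_derivative blinfun_apply (f' x)) (at x)) \<and>
     (\<forall>x\<in>U. (f' has_derivative blinfun_apply (f'' x)) (at x)) \<and>
     (\<forall>x\<in>U. \<bar>f x\<bar> \<le> B \<and> norm (f' x) \<le> B \<and> norm (f'' x) \<le> B) \<and>
     (\<forall>x\<in>U. \<forall>y\<in>U. norm (f'' x - f'' y) \<le> C * dist x y powr s))"

definition C11_fun :: "('a::euclidean_space \<Rightarrow> real) \<Rightarrow> bool" where
  "C11_fun g \<longleftrightarrow> (\<exists>(g' :: 'a \<Rightarrow> 'a \<Rightarrow>\<^sub>L real) L.
     (\<forall>x. (g has_derivative blinfun_apply (g' x)) (at x)) \<and>
     (\<forall>x y. norm (g' x - g' y) \<le> L * dist x y))"

text \<open>C^{1,1} boundary: near each boundary point p, after a rotation (unit normal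
  direction e) the set is the supergraph of a C^{1,1} function of the coordinates
  orthogonal to e (centred at p).\<close>
definition C11_boundary :: "'a::euclidean_space set \<Rightarrow> bool" where
  "C11_boundary \<Omega> \<longleftrightarrow> (\<forall>p\<in>frontier \<Omega>. \<exists>r>0. \<exists>e \<gamma>. norm e = 1 \<and> C11_fun \<gamma> \<and>
     \<Omega> \<inter> ball p r = {x \<in> ball p r. (x - p) \<bullet> e > \<gamma> ((x - p) - ((x - p) \<bullet> e) *\<^sub>R e)})"

definition test_fun :: "'a::euclidean_space set \<Rightarrow> ('a \<Rightarrow> real) \<Rightarrow> bool" where
  "test_fun \<Omega> \<phi> \<longleftrightarrow> (\<exists>(\<phi>' :: 'a \<Rightarrow> 'a \<Rightarrow>\<^sub>L real).
        (\<forall>x. (\<phi> has_derivative blinfun_apply (\<phi>' x)) (at x)) \<and> continuous_on UNIV \<phi>') \<and>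
     compact (closure {x. \<phi> x \<noteq> 0}) \<and> closure {x. \<phi> x \<noteq> 0} \<subseteq> \<Omega>"

definition frac_solution :: "'a::euclidean_space set \<Rightarrow> real \<Rightarrow> ('a \<Rightarrow> real \<Rightarrow> real)
     \<Rightarrow> ('a \<Rightarrow> real) \<Rightarrow> ('a \<Rightarrow> real) \<Rightarrow> ('a \<Rightarrow> real) \<Rightarrow> bool" where
  "frac_solution \<Omega> s A F f u \<longleftrightarrow> holder_on UNIV s u \<and> (\<forall>x \<in> - closure \<Omega>. u x = f x) \<and>
     (\<forall>\<phi>. test_fun \<Omega> \<phi> \<longrightarrow>
        frac_form s u \<phi> + (\<integral>x. indicator \<Omega> x * A x (u x) * \<phi> x \<partial>lebesgue)
          = (\<integral>x. indicator \<Omega> x * F x * \<phi> x \<partial>lebesgue))"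

end

theory Submission
  imports Defs
begin

text \<open>
  The main tool is unique continuation for \<open>(-\<Delta>)\<^sup>s\<close>: a bounded continuous \<open>v\<close> that vanishes on a ball,
  together with its Riesz potential \<open>V(x) = \<integral> v(y) |x - y| powr - (n + 2 * s) dy\<close>, vanishes everywhere.
  Differentiating \<open>V = 0\<close> twice in \<open>x\<close> raises the exponent by 2 and inserts factors \<open>(y - x0) \<bullet> i\<close> under the
  integral, so \<open>v(y) |x0 - y| powr - (n + 2 * s)\<close> annihilates all polynomials in the Kelvin variable
  \<open>z = (y - x0) / |y - x0|\<^sup>2\<close>, which stays in a compact ball. By Stone-Weierstrass it annihilates
  \<open>v(x0 + z / |z|\<^sup>2) |z|\<close>, hence \<open>\<integral> v(y)\<^sup>2 |x0 - y| powr - (n + 2 * s + 1) dy = 0\<close>.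

  Applied to the difference of the two solutions for the same exterior datum on a ball in \<open>W2\<close>, this shows
  that they coincide. Applied to the difference of the solutions for \<open>f k\<close> and \<open>f l\<close> on a ball in \<open>\<Omega>\<close> where
  these agree, it contradicts \<open>f k \<noteq> f l\<close>; hence the \<open>N + 1\<close> solutions take distinct values on a dense subset
  of \<open>\<Omega>\<close>. Subtracting the two equations, the polynomial with coefficients \<open>a1 m x - a2 m x\<close> takes the value
  \<open>F1 x - F2 x\<close> at these \<open>N + 1\<close> points, so its nonconstant coefficients vanish.
\<close>

section \<open>Integrability of Riesz kernels\<close>

text \<open>Unique continuation is needed in two forms. In \<open>W2\<close> the operator is a
  pointwise principal value, which converges because both solutions equal a C^2 datum there. Inside
  \<Omega> the solutions are merely Hoelder continuous and only the weak equation is available. Both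
  forms reduce to the same statement about V, because v vanishes on the ball in question: the kernel
  is never singular there, cut-offs drop out of the difference, and derivatives may be taken under
  the integral as often as desired. The Laplacian of |x|^(-b) is b * (b + 2 - n) * |x|^(-(b + 2)),
  and the exponents start at n + 2 * s, so this factor never vanishes. A homogeneous polynomial of
  degree d in y - x0 then comes with 2 * d extra powers of the distance, which is the same
  polynomial evaluated at z. The factor |z| in the approximated function restores continuity at z =
  0, the image of infinity, where a bounded v need not have a limit. The \<open>N + 1\<close> data
  match the \<open>N\<close> coefficients together with the source, which acts as the constant term
  of the polynomial.\<close>

lemma distr_lborel_affine_isometry:
  fixes t :: "'a::euclidean_space"
  assumes "\<bar>c\<bar> = 1"
  shows "distr lborel borel (\<lambda>x. t + c *\<^sub>R x) = (lborel :: 'a measure)"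
  using lborel_affine[of c t] assms by (auto simp: density_1)

text \<open>With |c| = 1 the Jacobian is 1. Translations (c = 1) recentre kernels; the reflection c
  = -1 pairs h with -h in the principal value and handles k (x - y) in convolutions.\<close>

lemma lborel_affine_isometry:
  fixes t :: "'a::euclidean_space" and g :: "'a \<Rightarrow> real"
  assumes "\<bar>c\<bar> = 1" and [measurable]: "g \<in> borel_measurable borel"
  shows integral_lborel_affine: "(\<integral>x. g (t + c *\<^sub>R x) \<partial>lborel) = (\<integral>x. g x \<partial>lborel)"
    and integrable_lborel_affine:
      "integrable lborel (\<lambda>x. g (t + c *\<^sub>R x)) \<longleftrightarrow> integrable lborel g"
proof -
  note * = distr_lborel_affine_isometry[OF assms(1), of t]
  show "(\<integral>x. g (t + c *\<^sub>R x) \<partial>lborel) = (\<integral>x. g x \<partial>lborel)"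
    by (subst *[symmetric], subst integral_distr) auto
  show "integrable lborel (\<lambda>x. g (t + c *\<^sub>R x)) \<longleftrightarrow> integrable lborel g"
    by (subst *[symmetric], subst integrable_distr_eq) auto
qed

text \<open>A function below some term at each point is below the whole series, whose integral is
  computed termwise. The terms may overlap, so dyadic balls can stand in for dyadic shells.\<close>

lemma integrable_le_some_summand:
  fixes f :: "'a \<Rightarrow> real" and g :: "nat \<Rightarrow> 'a \<Rightarrow> real"
  assumes f[measurable]: "f \<in> borel_measurable M" and g: "\<And>k. integrable M (g k)"
    and nonneg: "\<And>x. 0 \<le> f x" "\<And>k x. 0 \<le> g k x"
    and summ: "summable (\<lambda>k. \<integral>x. g k x \<partial>M)" and le: "\<And>x. \<exists>k. f x \<le> g k x"
  shows "integrable M f"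
proof (rule integrableI_bounded)
  have [measurable]: "g k \<in> borel_measurable M" for k using g by auto
  have "(\<integral>\<^sup>+x. ennreal (norm (f x)) \<partial>M) \<le> (\<integral>\<^sup>+x. (\<Sum>k. ennreal (g k x)) \<partial>M)"
  proof (rule nn_integral_mono)
    fix x
    obtain k where "f x \<le> g k x" using le by blast
    then have "ennreal (norm (f x)) \<le> (\<Sum>k\<in>{k}. ennreal (g k x))"
      using nonneg by (simp add: ennreal_leI)
    also have "\<dots> \<le> (\<Sum>k. ennreal (g k x))" by (rule sum_le_suminf) auto
    finally show "ennreal (norm (f x)) \<le> (\<Sum>k. ennreal (g k x))" .
  qed
  also have "\<dots> = (\<Sum>k. \<integral>\<^sup>+x. ennreal (g k x) \<partial>M)" by (rule nn_integral_suminf) auto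
  also have "\<dots> = (\<Sum>k. ennreal (\<integral>x. g k x \<partial>M))"
    using g nonneg by (simp add: nn_integral_eq_integral)
  also have "\<dots> = ennreal (\<Sum>k. \<integral>x. g k x \<partial>M)"
    by (rule suminf_ennreal2) (use nonneg summ in auto)
  also have "\<dots> < \<infinity>" by simp
  finally show "(\<integral>\<^sup>+x. ennreal (norm (f x)) \<partial>M) < \<infinity>" .
qed fact

lemma content_cball_two_powr:
  "measure lborel (cball (0::'a::euclidean_space) (2 powr p))
     = 2 powr (p * DIM('a)) * measure lborel (ball (0::'a) 1)"
  using content_ball_conv_unit_ball[of "2 powr p" "0::'a"]
  by (simp add: content_cball_conv_ball powr_powr flip: powr_realpow)

lemma integrable_const_cball:
  fixes c r :: real
  shows
  "integrable lborel (\<lambda>h::'a::euclidean_space. c * indicator (cball 0 r) h :: real)"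
  by (intro integrable_mult_right integrable_real_indicator) (use emeasure_lborel_cball_finite[of 0 r] in auto)

lemma summable_two_powr:
  fixes c \<beta> d :: real
  assumes "\<beta> > 0"
  shows "summable (\<lambda>k::nat. c * 2 powr (- \<beta> * real k + d))"
proof -
  have "2 powr (- \<beta> * real k + d) = (2 powr - \<beta>) ^ k * 2 powr d" for k :: nat
    by (simp add: powr_powr algebra_simps flip: powr_realpow powr_add)
  moreover have "2 powr - \<beta> < 1" using assms by (simp add: powr_less_one)
  ultimately show ?thesis by (auto intro!: summable_mult summable_mult2 summable_geometric)
qed

text \<open>On the shell 2^(-(k+1)) < |h| <= 2^(-k) the factors |h|^\<beta> and |h|^(-n) are bounded
  separately, by 2^(-\<beta> k) and 2^((k+1) n), which works for either sign of \<beta> - n. The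
  ball volume 2^(-k n) cancels the growth and leaves a geometric series of ratio
  2^(-\<beta>).\<close>

lemma integrable_norm_powr_near:
  fixes \<beta> :: real
  assumes "\<beta> > 0"
  shows "integrable lborel (\<lambda>h::'a::euclidean_space.
           indicator (cball 0 1) h * norm h powr (\<beta> - DIM('a)))"
proof (rule integrable_le_some_summand[where
      g = "\<lambda>k h. 2 powr (- \<beta> * real k + (real k + 1) * DIM('a)) * indicator (cball 0 (2 powr - real k)) h"])
  let ?c = "\<lambda>k::nat. 2 powr (- \<beta> * real k + (real k + 1) * DIM('a)) :: real"
  show "summable (\<lambda>k. \<integral>h. ?c k * indicator (cball (0::'a) (2 powr - real k)) h \<partial>lborel)"
  proof -
    have "(\<integral>h. ?c k * indicator (cball (0::'a) (2 powr - real k)) h \<partial>lborel)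
        = measure lborel (ball (0::'a) 1) * 2 powr (- \<beta> * real k + DIM('a))" for k
      by (simp add: content_cball_two_powr algebra_simps flip: powr_add)
    then show ?thesis by (simp only: summable_two_powr[OF assms])
  qed
  show "(\<lambda>h::'a. indicator (cball 0 1) h * norm h powr (\<beta> - DIM('a))) \<in> borel_measurable lborel"
    by (intro borel_measurable_times borel_measurable_indicator) (simp_all add: borel_closed)
  fix h :: 'a
  show "\<exists>k. indicator (cball 0 1) h * norm h powr (\<beta> - DIM('a))
            \<le> ?c k * indicator (cball 0 (2 powr - real k)) h"
  proof (cases "h \<noteq> 0 \<and> norm h \<le> 1")
    case True
    define k where "k = nat \<lfloor>- log 2 (norm h)\<rfloor>"
    have "- log 2 (norm h) \<ge> 0" using True by simp
    then have k: "real k \<le> - log 2 (norm h)" "- log 2 (norm h) < real k + 1"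
      unfolding k_def by linarith+
    have eq: "2 powr (log 2 (norm h)) = norm h" using True by simp
    have up: "norm h \<le> 2 powr - real k"
      by (subst eq[symmetric]) (use k in \<open>auto intro: powr_mono\<close>)
    have "norm h powr (\<beta> - DIM('a)) = 2 powr (log 2 (norm h) * \<beta> - log 2 (norm h) * DIM('a))"
      by (subst eq[symmetric], subst powr_powr) (simp add: algebra_simps)
    also have "\<dots> \<le> ?c k"
    proof (rule powr_mono)
      have "log 2 (norm h) * \<beta> \<le> - real k * \<beta>" using k assms by (intro mult_right_mono) auto
      moreover have "- log 2 (norm h) * DIM('a) \<le> (real k + 1) * DIM('a)"
        using k by (intro mult_right_mono) auto
      ultimately show "log 2 (norm h) * \<beta> - log 2 (norm h) * DIM('a)
          \<le> - \<beta> * real k + (real k + 1) * DIM('a)" by (simp add: algebra_simps)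
    qed simp
    finally show ?thesis using up True by (intro exI[of _ k]) auto
  next
    case False
    \<comment> \<open>At h = 0 the left side is 0 because \<open>0 powr p = 0\<close> for every
      exponent p.\<close>
    then show ?thesis by (intro exI[of _ 0]) (auto simp: indicator_def)
  qed
qed (use integrable_const_cball in \<open>auto simp del: powr_zero_eq_one\<close>)

text \<open>The exponent is negative, so on 2^k <= |h| < 2^(k+1) the inner radius gives the constant
  and the outer one the volume; the product is 2^(-\<beta> k + n) times the unit volume.\<close>

lemma integrable_norm_powr_far:
  fixes \<beta> :: real
  assumes "\<beta> > 0"
  shows "integrable lborel (\<lambda>h::'a::euclidean_space.
           indicator {h. 1 \<le> norm h} h * norm h powr (- \<beta> - DIM('a)))"
proof (rule integrable_le_some_summand[where
      g = "\<lambda>k h. 2 powr ((- \<beta> - DIM('a)) * real k) * indicator (cball 0 (2 powr (real k + 1))) h"])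
  let ?c = "\<lambda>k::nat. 2 powr ((- \<beta> - DIM('a)) * real k) :: real"
  show "summable (\<lambda>k. \<integral>h. ?c k * indicator (cball (0::'a) (2 powr (real k + 1))) h \<partial>lborel)"
  proof -
    have "(\<integral>h. ?c k * indicator (cball (0::'a) (2 powr (real k + 1))) h \<partial>lborel)
        = measure lborel (ball (0::'a) 1) * 2 powr (- \<beta> * real k + DIM('a))" for k
      by (simp only: integral_mult_right_zero integral_indicator)
         (simp add: content_cball_two_powr algebra_simps flip: powr_add)
    then show ?thesis by (simp only: summable_two_powr[OF assms])
  qed
  fix h :: 'a
  show "\<exists>k. indicator {h. 1 \<le> norm h} h * norm h powr (- \<beta> - DIM('a))
            \<le> ?c k * indicator (cball 0 (2 powr (real k + 1))) h"
  proof (cases "1 \<le> norm h")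
    case True
    then have "h \<noteq> 0" by auto
    define k where "k = nat \<lfloor>log 2 (norm h)\<rfloor>"
    have "log 2 (norm h) \<ge> 0" using True \<open>h \<noteq> 0\<close> by (simp add: le_log_iff)
    then have k: "real k \<le> log 2 (norm h)" "log 2 (norm h) < real k + 1"
      unfolding k_def by linarith+
    have eq: "2 powr (log 2 (norm h)) = norm h" using True \<open>h \<noteq> 0\<close> by simp
    have up: "norm h \<le> 2 powr (real k + 1)"
      by (subst eq[symmetric]) (use k in \<open>auto intro: powr_mono\<close>)
    have "norm h powr (- \<beta> - DIM('a)) = 2 powr (log 2 (norm h) * (- \<beta> - DIM('a)))"
      by (subst eq[symmetric], subst powr_powr) simp
    also have "\<dots> \<le> ?c k"
    proof (rule powr_mono)
      show "log 2 (norm h) * (- \<beta> - DIM('a)) \<le> (- \<beta> - DIM('a)) * real k"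
        using k assms by (subst (2) mult.commute, intro mult_right_mono_neg) auto
    qed simp
    finally show ?thesis using up True by (intro exI[of _ k]) auto
  next
    case False
    then show ?thesis by (intro exI[of _ 0]) (auto simp: indicator_def)
  qed
qed (use integrable_const_cball in auto)

text \<open>Vanishing to order p > \<sigma> at the origin tames the singularity; boundedness
  suffices at infinity. It is applied to a cut-off (p = \<sigma> + 1), to second differences (p = 2)
  and to the product of a Hoelder and a Lipschitz increment (p = 1 + s); the last two exceed 2 * s
  exactly when s < 1.\<close>

lemma integrable_mult_kernel:
  fixes g :: "'a::euclidean_space \<Rightarrow> real" and \<sigma> p C :: real
  assumes "0 < \<sigma>" "\<sigma> < p" and g[measurable]: "g \<in> borel_measurable borel"
    and near: "\<And>h. \<bar>g h\<bar> \<le> C * norm h powr p" and far: "\<And>h. \<bar>g h\<bar> \<le> C"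
  shows "integrable lborel (\<lambda>h. g h * norm h powr - (DIM('a) + \<sigma>))"
proof (rule Bochner_Integration.integrable_bound)
  show "integrable lborel (\<lambda>h::'a.
     C * (indicator (cball 0 1) h * norm h powr ((p - \<sigma>) - DIM('a)))
   + C * (indicator {h. 1 \<le> norm h} h * norm h powr (- \<sigma> - DIM('a))))"
    using assms(1,2) by (intro Bochner_Integration.integrable_add integrable_mult_right
        integrable_norm_powr_near integrable_norm_powr_far) auto
  have C: "0 \<le> C" using far[of 0] by simp
  have "norm (g h * norm h powr - (DIM('a) + \<sigma>)) \<le>
      C * (indicator (cball 0 1) h * norm h powr ((p - \<sigma>) - DIM('a)))
   + C * (indicator {h. 1 \<le> norm h} h * norm h powr (- \<sigma> - DIM('a)))" for h
  proof (cases "norm h \<le> 1")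
    case True
    have "norm (g h * norm h powr - (DIM('a) + \<sigma>)) \<le> (C * norm h powr p) * norm h powr - (DIM('a) + \<sigma>)"
      unfolding norm_mult using near[of h] by (intro mult_mono) auto
    also have "\<dots> = C * norm h powr ((p - \<sigma>) - DIM('a))"
      by (simp add: mult.assoc algebra_simps flip: powr_add)
    finally show ?thesis using True C by (simp add: indicator_def add_increasing2)
  next
    case False
    have "norm (g h * norm h powr - (DIM('a) + \<sigma>)) \<le> C * norm h powr - (DIM('a) + \<sigma>)"
      unfolding norm_mult using far[of h] by (intro mult_mono) auto
    then show ?thesis using False by (simp add: indicator_def algebra_simps)
  qed
  then show "AE h in lborel. norm (g h * norm h powr - (DIM('a) + \<sigma>)) \<le>
      norm (C * (indicator (cball 0 1) h * norm h powr ((p - \<sigma>) - DIM('a)))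
   + C * (indicator {h. 1 \<le> norm h} h * norm h powr (- \<sigma> - DIM('a))))"
    using C by (auto intro!: AE_I2 order_trans[OF _ abs_ge_self])
qed simp

lemma integrable_kernel_outside_ball:
  fixes x :: "'a::euclidean_space" and r \<sigma> :: real
  assumes "0 < \<sigma>" "0 < r"
  shows "integrable lborel (\<lambda>y. indicator (- ball x r) y * dist x y powr - (DIM('a) + \<sigma>) :: real)"
proof -
  have "integrable lborel (\<lambda>h::'a. indicator (- ball 0 r) h * norm h powr - (DIM('a) + \<sigma>) :: real)"
  proof (rule integrable_mult_kernel[where p = "\<sigma> + 1" and C = "max 1 (r powr - (\<sigma> + 1))"])
    fix h :: 'a
    show "\<bar>indicator (- ball 0 r) h\<bar> \<le> max 1 (r powr - (\<sigma> + 1)) * norm h powr (\<sigma> + 1)"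
    proof (cases "h \<in> ball 0 r")
      case False
      have "(1::real) = r powr - (\<sigma> + 1) * r powr (\<sigma> + 1)" using assms by (simp flip: powr_add)
      also have "\<dots> \<le> max 1 (r powr - (\<sigma> + 1)) * norm h powr (\<sigma> + 1)"
        using False assms by (intro mult_mono powr_mono2) auto
      finally show ?thesis using False by simp
    qed simp
  qed (use assms in \<open>auto simp: indicator_def\<close>)
  then have "integrable lborel (\<lambda>h::'a. indicator (- ball 0 r) (- x + 1 *\<^sub>R h)
       * norm (- x + 1 *\<^sub>R h) powr - (DIM('a) + \<sigma>) :: real)"
    by (subst integrable_lborel_affine[where g = "\<lambda>h. indicator (- ball 0 r) h
       * norm h powr - (DIM('a) + \<sigma>)"]) auto
  then show ?thesis
    by (rule Bochner_Integration.integrable_cong[THEN iffD1, rotated -1])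
       (auto simp: dist_norm norm_minus_commute indicator_def)
qed

section \<open>Unique continuation for Riesz potentials\<close>

text \<open>Difference quotients of an identically zero integral have integral zero; the mean value
  theorem bounds them by w, so dominated convergence passes to the derivative.\<close>

lemma integral_deriv_eq_0:
  fixes f f' :: "real \<Rightarrow> 'a \<Rightarrow> real"
  assumes "\<delta> > 0" and int: "\<And>t. \<bar>t\<bar> < \<delta> \<Longrightarrow> integrable M (f t)"
    and zero: "\<And>t. \<bar>t\<bar> < \<delta> \<Longrightarrow> (\<integral>y. f t y \<partial>M) = 0"
    and der: "\<And>t y. \<bar>t\<bar> < \<delta> \<Longrightarrow> ((\<lambda>t. f t y) has_real_derivative f' t y) (at t)"
    and bound: "\<And>t y. \<bar>t\<bar> < \<delta> \<Longrightarrow> \<bar>f' t y\<bar> \<le> w y" and w: "integrable M w"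
  shows "integrable M (f' 0)" "(\<integral>y. f' 0 y \<partial>M) = 0"
proof -
  \<comment> \<open>The offset 2 makes every increment, including the one for k = 0, strictly
    smaller than \<delta>.\<close>
  define \<tau> where "\<tau> k = \<delta> / (real k + 2)" for k :: nat
  have \<tau>: "0 < \<tau> k" "\<tau> k < \<delta>" for k
    using \<open>\<delta> > 0\<close> unfolding \<tau>_def by (auto simp: field_simps add_pos_nonneg)
  have lim0: "\<tau> \<longlonglongrightarrow> 0" unfolding \<tau>_def by real_asymp
  define q where "q k y = (f (\<tau> k) y - f 0 y) / \<tau> k" for k y
  have int_q: "integrable M (q k)" for k
    unfolding q_def using int[of 0] int[of "\<tau> k"] \<tau>[of k] \<open>\<delta> > 0\<close> by auto
  have zero_q: "(\<integral>y. q k y \<partial>M) = 0" for k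
    unfolding q_def using int[of 0] int[of "\<tau> k"] zero[of 0] zero[of "\<tau> k"] \<tau>[of k] \<open>\<delta> > 0\<close> by auto
  have lim: "(\<lambda>k. q k y) \<longlonglongrightarrow> f' 0 y" for y
  proof -
    have "((\<lambda>h. (f h y - f 0 y) / h) \<longlongrightarrow> f' 0 y) (at 0)"
      using der[of 0 y] \<open>\<delta> > 0\<close> by (simp add: DERIV_def)
    moreover have "filterlim \<tau> (at 0) sequentially"
      using lim0 \<tau>(1) by (auto simp: filterlim_at intro!: always_eventually) (metis less_irrefl)
    ultimately show ?thesis unfolding q_def by (rule filterlim_compose)
  qed
  have bound_q: "norm (q k y) \<le> w y" for k y
  proof -
    have "\<exists>z. 0 < z \<and> z < \<tau> k \<and> f (\<tau> k) y - f 0 y = (\<tau> k - 0) * f' z y"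
      by (rule MVT2) (use \<tau>[of k] der in auto)
    then obtain z where z: "0 < z" "z < \<tau> k" "f (\<tau> k) y - f 0 y = \<tau> k * f' z y" by auto
    then have "q k y = f' z y" using \<tau>(1)[of k] by (simp add: q_def)
    then show ?thesis using bound[of z y] z \<tau>(2)[of k] by simp
  qed
  have [measurable]: "q k \<in> borel_measurable M" for k using int_q by auto
  have [measurable]: "f' 0 \<in> borel_measurable M"
    by (rule borel_measurable_LIMSEQ_metric[where f = q]) (use lim in auto)
  show "integrable M (f' 0)"
    by (rule integrable_dominated_convergence[where s = q and w = w])
       (use lim bound_q w in auto)
  have "(\<lambda>k. \<integral>y. q k y \<partial>M) \<longlonglongrightarrow> (\<integral>y. f' 0 y \<partial>M)"
    by (rule integral_dominated_convergence[where w = w]) (use lim bound_q w in auto)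
  then show "(\<integral>y. f' 0 y \<partial>M) = 0"
    using LIMSEQ_unique[OF _ tendsto_const] by (auto simp: zero_q)
qed

section \<open>Differentiating Riesz potentials away from the singularity\<close>

lemma DERIV_norm_powr:
  fixes z i :: "'a::euclidean_space"
  assumes "z + t *\<^sub>R i \<noteq> 0"
  shows "((\<lambda>t. norm (z + t *\<^sub>R i) powr c) has_real_derivative
           c * ((z + t *\<^sub>R i) \<bullet> i) * norm (z + t *\<^sub>R i) powr (c - 2)) (at t)"
proof -
  have eq: "norm u powr p = (u \<bullet> u) powr (p / 2)" for u :: 'a and p
    by (simp add: norm_eq_sqrt_inner powr_half_sqrt[symmetric] powr_powr)
  have "((\<lambda>t. ((z + t *\<^sub>R i) \<bullet> (z + t *\<^sub>R i))) has_real_derivative 2 * ((z + t *\<^sub>R i) \<bullet> i)) (at t)"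
    by (auto intro!: derivative_eq_intros simp: has_field_derivative_def inner_commute algebra_simps)
  then have "((\<lambda>t. ((z + t *\<^sub>R i) \<bullet> (z + t *\<^sub>R i)) powr (c / 2)) has_real_derivative
      (c / 2) * ((z + t *\<^sub>R i) \<bullet> (z + t *\<^sub>R i)) powr (c / 2 - 1) * (2 * ((z + t *\<^sub>R i) \<bullet> i))) (at t)"
    by (rule DERIV_chain2[OF has_real_derivative_powr, rotated])
       (use assms inner_gt_zero_iff in blast)
  moreover have e: "(c - 2) / 2 = c / 2 - 1" by simp
  ultimately show ?thesis unfolding eq e by (simp add: mult_ac)
qed

lemma norm_powr_mult_self: "norm (z::'a::real_normed_vector) * norm z powr p = norm z powr (p + 1)"
  by (cases "z = 0") (simp_all add: powr_add)

lemma abs_inner_Basis_powr: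
  fixes z i :: "'a::euclidean_space"
  assumes "i \<in> Basis" "p' = p + 1"
  shows "\<bar>z \<bullet> i\<bar> * norm z powr p \<le> norm z powr p'"
  using mult_right_mono[OF Basis_le_norm[OF assms(1), of z], of "norm z powr p"] assms(2)
  by (simp add: norm_powr_mult_self)

context
  fixes x0 :: "'a::euclidean_space" and r \<sigma> b C :: real and q :: "'a \<Rightarrow> real"
  assumes r: "0 < r" and \<sigma>: "0 < \<sigma>" and q_meas[measurable]: "q \<in> borel_measurable borel"
    and q_zero: "\<And>y. y \<in> ball x0 r \<Longrightarrow> q y = 0"
    and b: "0 \<le> b"
    and q_bound: "\<And>y. \<bar>q y\<bar> \<le> C * norm (y - x0) powr (b - DIM('a) - \<sigma>)"
begin

text \<open>For x in the half ball and y outside the full ball, |x - y| >= |y - x0| / 2. The growth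
  b - n - \<sigma> allowed for q is such that q times |y - x0|^(-b) still decays like |y - x0|^(-n -
  \<sigma>), which is integrable there; surplus decay e is traded for r^(-e). The bound does not
  depend on x, as dominated convergence requires.\<close>

lemma kernel_dominated:
  assumes "x \<in> ball x0 (r/2)" "0 \<le> e"
  shows "\<bar>q y\<bar> * norm (x - y) powr - (b + e)
    \<le> C * 2 powr (b + e) * r powr - e * (indicator (- ball x0 r) y * dist x0 y powr - (DIM('a) + \<sigma>))"
proof (cases "y \<in> ball x0 r")
  case False
  then have y: "r \<le> norm (y - x0)" by (simp add: dist_norm norm_minus_commute)
  have xn: "norm (x - x0) < r / 2" using assms by (simp add: dist_norm norm_minus_commute)
  have le: "norm (y - x0) / 2 \<le> norm (x - y)"
    using norm_triangle_ineq[of "y - x" "x - x0"] xn y by (simp add: norm_minus_commute)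
  have pos: "0 < norm (y - x0)" using y r by linarith
  have C: "0 \<le> C" using order_trans[OF abs_ge_zero q_bound[of y]] pos by (simp add: zero_le_mult_iff)
  have "\<bar>q y\<bar> * norm (x - y) powr - (b + e)
      \<le> (C * norm (y - x0) powr (b - DIM('a) - \<sigma>)) * (norm (y - x0) / 2) powr - (b + e)"
    using q_bound le pos b assms C by (intro mult_mono powr_mono2') auto
  also have "\<dots> = C * 2 powr (b + e) * (norm (y - x0) powr - (DIM('a) + \<sigma>) * norm (y - x0) powr - e)"
  proof -
    let ?N = "\<lambda>p. norm (y - x0) powr p"
    have "(norm (y - x0) / 2) powr - (b + e) = ?N (- (b + e)) * 2 powr (b + e)"
      using powr_minus_divide[of 2 "b + e"] by (simp add: powr_divide)
    then have "(C * ?N (b - DIM('a) - \<sigma>)) * (norm (y - x0) / 2) powr - (b + e)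
       = C * 2 powr (b + e) * (?N (b - DIM('a) - \<sigma>) * ?N (- (b + e)))" by (simp only: mult_ac)
    also have "?N (b - DIM('a) - \<sigma>) * ?N (- (b + e)) = ?N (- (DIM('a) + \<sigma>)) * ?N (- e)"
      unfolding powr_add[symmetric] by (rule arg_cong[where f = ?N]) simp
    finally show ?thesis .
  qed
  also have "\<dots> \<le> C * 2 powr (b + e) * (norm (y - x0) powr - (DIM('a) + \<sigma>) * r powr - e)"
    using C y r assms by (intro mult_left_mono powr_mono2') auto
  finally show ?thesis using False by (simp add: dist_norm norm_minus_commute mult_ac)
qed (auto simp: q_zero)

lemma kernel_integrable:
  assumes "x \<in> ball x0 (r/2)" "0 \<le> e" and [measurable]: "k \<in> borel_measurable borel"
    and k: "\<And>y. \<bar>k y\<bar> \<le> D * norm (x - y) powr - (b + e)"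
  shows "integrable lborel (\<lambda>y. q y * k y)"
proof (rule Bochner_Integration.integrable_bound)
  show "integrable lborel (\<lambda>y. D * (C * 2 powr (b + e) * r powr - e * (indicator (- ball x0 r) y * dist x0 y powr - (DIM('a) + \<sigma>))))"
    by (intro integrable_mult_right integrable_kernel_outside_ball r \<sigma>)
  have D: "0 \<le> D"
    using order_trans[OF abs_ge_zero k[of "x + (SOME i. i \<in> Basis)"]] 
    by (simp add: zero_le_mult_iff SOME_Basis) 
  have "\<bar>q y * k y\<bar> \<le> D * (C * 2 powr (b + e) * r powr - e * (indicator (- ball x0 r) y * dist x0 y powr - (DIM('a) + \<sigma>)))" for y
  proof -
    have "\<bar>q y * k y\<bar> \<le> \<bar>q y\<bar> * (D * norm (x - y) powr - (b + e))"
      unfolding abs_mult using k by (intro mult_left_mono) auto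
    also have "\<dots> = D * (\<bar>q y\<bar> * norm (x - y) powr - (b + e))" by simp
    finally show ?thesis using mult_left_mono[OF kernel_dominated[OF assms(1,2), of y] D] by linarith
  qed
  then show "AE y in lborel. norm (q y * k y) \<le> norm (D * (C * 2 powr (b + e) * r powr - e * (indicator (- ball x0 r) y * dist x0 y powr - (DIM('a) + \<sigma>))))"
    by (auto intro!: AE_I2 order_trans[OF _ abs_ge_self])
qed simp

text \<open>Here k' is the derivative of k along i, and e, e' record the orders of the two kernels.
  The singularity is never reached: q vanishes on the ball of radius r while x moves in the half
  ball. Hypothesis and conclusion concern the same half ball, so differentiation can be iterated
  without shrinking it.\<close>

lemma kernel_deriv:
  fixes k k' :: "'a \<Rightarrow> real"
  assumes i: "i \<in> Basis" and e: "0 \<le> e" "0 \<le> e'" 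
    and [measurable]: "k \<in> borel_measurable borel"
    and k: "\<And>z. \<bar>k z\<bar> \<le> D * norm z powr - (b + e)"
    and k': "\<And>z. \<bar>k' z\<bar> \<le> D' * norm z powr - (b + e')"
    and der: "\<And>z t. z + t *\<^sub>R i \<noteq> 0 \<Longrightarrow>
       ((\<lambda>t. k (z + t *\<^sub>R i)) has_real_derivative k' (z + t *\<^sub>R i)) (at t)"
    and zero: "\<And>x. x \<in> ball x0 (r/2) \<Longrightarrow> (\<integral>y. q y * k (x - y) \<partial>lborel) = 0"
    and x: "x \<in> ball x0 (r/2)"
  shows "(\<integral>y. q y * k' (x - y) \<partial>lborel) = 0"
proof -
  obtain \<delta> where \<delta>: "\<delta> > 0" "ball x \<delta> \<subseteq> ball x0 (r/2)"
    using x open_contains_ball open_ball by metis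
  have D': "0 \<le> D'" using order_trans[OF abs_ge_zero k'[of i]] i by simp
  have near: "x + t *\<^sub>R i \<in> ball x0 (r/2)" if "\<bar>t\<bar> < \<delta>" for t
    using \<delta>(2) that i by (intro subsetD[OF \<delta>(2)]) (simp add: dist_norm)
  have "(\<integral>y. q y * k' (x + 0 *\<^sub>R i - y) \<partial>lborel) = 0"
  proof (rule integral_deriv_eq_0(2)[OF \<delta>(1), where f = "\<lambda>t y. q y * k (x + t *\<^sub>R i - y)"
        and f' = "\<lambda>t y. q y * k' (x + t *\<^sub>R i - y)"])
    show "integrable lborel (\<lambda>y. D' * (C * 2 powr (b + e') * r powr - e' * (indicator (- ball x0 r) y * dist x0 y powr - (DIM('a) + \<sigma>))))"
      by (intro integrable_mult_right integrable_kernel_outside_ball r \<sigma>)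
    fix t assume t: "\<bar>t\<bar> < \<delta>"
    show "integrable lborel (\<lambda>y. q y * k (x + t *\<^sub>R i - y))"
      by (rule kernel_integrable[OF near[OF t] e(1)]) (use k in auto)
    show "(\<integral>y. q y * k (x + t *\<^sub>R i - y) \<partial>lborel) = 0"
      by (rule zero[OF near[OF t]])
    fix y
    show "((\<lambda>t. q y * k (x + t *\<^sub>R i - y)) has_real_derivative q y * k' (x + t *\<^sub>R i - y)) (at t)"
    proof (cases "y \<in> ball x0 r")
      case False
      then have "x + t *\<^sub>R i \<noteq> y" using near[OF t] r by auto
      then have "((\<lambda>t. k ((x - y) + t *\<^sub>R i)) has_real_derivative k' ((x - y) + t *\<^sub>R i)) (at t)"
        by (intro der) (auto simp: algebra_simps)
      then show ?thesis by (intro DERIV_cmult) (simp add: algebra_simps)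
    qed (simp add: q_zero)
    have "\<bar>q y * k' (x + t *\<^sub>R i - y)\<bar> \<le> \<bar>q y\<bar> * (D' * norm (x + t *\<^sub>R i - y) powr - (b + e'))"
      unfolding abs_mult using k' by (intro mult_left_mono) auto
    also have "\<dots> = D' * (\<bar>q y\<bar> * norm (x + t *\<^sub>R i - y) powr - (b + e'))" by simp
    also have "\<dots> \<le> D' * (C * 2 powr (b + e') * r powr - e' * (indicator (- ball x0 r) y * dist x0 y powr - (DIM('a) + \<sigma>)))"
      by (rule mult_left_mono[OF kernel_dominated[OF near[OF t] e(2)] D'])
    finally show "\<bar>q y * k' (x + t *\<^sub>R i - y)\<bar> \<le> D' * (C * 2 powr (b + e') * r powr - e' * (indicator (- ball x0 r) y * dist x0 y powr - (DIM('a) + \<sigma>)))" .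
  qed
  then show ?thesis by simp
qed

text \<open>Since \<open>\<Delta> |x| powr -b = b * (b + 2 - n) * |x| powr - (b + 2)\<close>, a potential vanishing on a ball
  forces the vanishing of the potential with the exponent raised by 2.\<close>
lemma potential_step:
  assumes bn: "DIM('a) < b + 2" "0 < b"
    and zero: "\<And>x. x \<in> ball x0 (r/2) \<Longrightarrow> (\<integral>y. q y * norm (x - y) powr - b \<partial>lborel) = 0"
    and x: "x \<in> ball x0 (r/2)"
  shows "(\<integral>y. q y * norm (x - y) powr - (b + 2) \<partial>lborel) = 0" (is "?I = 0")
    and "i \<in> Basis \<Longrightarrow> (\<integral>y. (q y * ((y - x0) \<bullet> i)) * norm (x - y) powr - (b + 2) \<partial>lborel) = 0"
proof -
  \<comment> \<open>Up to the factor -b, \<open>?G i\<close> is the partial derivative of |z|^(-b)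
    in direction i.\<close>
  let ?G = "\<lambda>i z::'a. (z \<bullet> i) * norm z powr - (b + 2)"
  have G_bound: "\<bar>?G i z\<bar> \<le> norm z powr - (b + 1)" if "i \<in> Basis" for i z
    using abs_inner_Basis_powr[OF that, of "- (b + 1)" "- (b + 2)" z] by (simp add: abs_mult)
  have first: "(\<integral>y. q y * ?G i (x - y) \<partial>lborel) = 0"
    if i: "i \<in> Basis" and x: "x \<in> ball x0 (r/2)" for i x
  proof -
    have "(\<integral>y. q y * (- b * ?G i (x - y)) \<partial>lborel) = 0"
    proof (rule kernel_deriv[where k = "\<lambda>z. norm z powr - b" and k' = "\<lambda>z. - b * ?G i z"
          and D = 1 and e = 0 and e' = 1 and D' = b, OF i _ _ _ _ _ _ _ x])
      show "\<bar>- b * ?G i z\<bar> \<le> b * norm z powr - (b + 1)" for z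
        using mult_left_mono[OF G_bound[OF i, of z], of b] bn by (simp add: abs_mult)
      show "((\<lambda>t. norm (z + t *\<^sub>R i) powr - b) has_real_derivative - b * ?G i (z + t *\<^sub>R i)) (at t)"
        if "z + t *\<^sub>R i \<noteq> 0" for z t
        using DERIV_norm_powr[OF that, of "- b"] by (simp add: algebra_simps)
    qed (use zero in auto)
    then show ?thesis using bn by (simp add: mult.left_commute[of _ b])
  qed
  have int0: "integrable lborel (\<lambda>y. q y * norm (x - y) powr - (b + 2))"
    by (rule kernel_integrable[OF x, where e = 2 and D = 1]) auto
  have G2_bound: "(z \<bullet> i)\<^sup>2 * norm z powr - (b + 4) \<le> norm z powr - (b + 2)" if "i \<in> Basis" for z i :: 'a
  proof -
    have "(z \<bullet> i)\<^sup>2 * norm z powr - (b + 4) = \<bar>z \<bullet> i\<bar> * (\<bar>z \<bullet> i\<bar> * norm z powr - (b + 4))"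
      by (simp add: power2_eq_square)
    also have "\<dots> \<le> \<bar>z \<bullet> i\<bar> * norm z powr - (b + 3)"
      using abs_inner_Basis_powr[OF that, of "- (b + 3)" "- (b + 4)" z] by (intro mult_left_mono) auto
    also have "\<dots> \<le> norm z powr - (b + 2)"
      using abs_inner_Basis_powr[OF that, of "- (b + 2)" "- (b + 3)" z] by simp
    finally show ?thesis .
  qed
  have int2: "integrable lborel (\<lambda>y. q y * (((x - y) \<bullet> i)\<^sup>2 * norm (x - y) powr - (b + 4)))"
    if i: "i \<in> Basis" for i
    by (rule kernel_integrable[OF x, where e = 2 and D = 1]) (use G2_bound[OF i] in auto)
  \<comment> \<open>Differentiating \<open>?G i\<close> once more in direction i gives |z|^(-(b +
    2)) - (b + 2) * (z \<bullet> i)^2 * |z|^(-(b + 4)). Its potential vanishes, which equates the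
    two contributions.\<close>
  have second: "?I = (b + 2) * (\<integral>y. q y * (((x - y) \<bullet> i)\<^sup>2 * norm (x - y) powr - (b + 4)) \<partial>lborel)"
    if i: "i \<in> Basis" for i
  proof -
    let ?k' = "\<lambda>z::'a. norm z powr - (b + 2) - (b + 2) * ((z \<bullet> i)\<^sup>2 * norm z powr - (b + 4))"
    have "(\<integral>y. q y * ?k' (x - y) \<partial>lborel) = 0"
    proof (rule kernel_deriv[where k = "?G i" and k' = ?k'
          and D = 1 and e = 1 and e' = 2 and D' = "b + 3", OF i _ _ _ _ _ _ _ x])
      fix z :: 'a
      show "\<bar>?G i z\<bar> \<le> 1 * norm z powr - (b + 1)" using G_bound[OF i] by simp
      have "\<bar>?k' z\<bar> \<le> norm z powr - (b + 2) + (b + 2) * ((z \<bullet> i)\<^sup>2 * norm z powr - (b + 4))"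
        using b by (intro order_trans[OF abs_triangle_ineq4]) (auto simp: abs_mult)
      also have "\<dots> \<le> norm z powr - (b + 2) + (b + 2) * norm z powr - (b + 2)"
        using G2_bound[OF i] b by (intro add_left_mono mult_left_mono) auto
      finally show "\<bar>?k' z\<bar> \<le> (b + 3) * norm z powr - (b + 2)" by (simp add: algebra_simps)
      fix t assume nz: "z + t *\<^sub>R i \<noteq> 0"
      have "((\<lambda>t. (z + t *\<^sub>R i) \<bullet> i) has_real_derivative 1) (at t)"
        using i by (auto intro!: derivative_eq_intros simp: has_field_derivative_def inner_Basis inner_commute algebra_simps)
      from DERIV_mult[OF this DERIV_norm_powr[OF nz, of "- (b + 2)"]]
      show "((\<lambda>t. ?G i (z + t *\<^sub>R i)) has_real_derivative ?k' (z + t *\<^sub>R i)) (at t)"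
        by (simp add: algebra_simps power2_eq_square)
    qed (use first i b in auto)
    moreover have "(\<integral>y. q y * ?k' (x - y) \<partial>lborel)
       = (\<integral>y. q y * norm (x - y) powr - (b + 2) - (b + 2) * (q y * (((x - y) \<bullet> i)\<^sup>2 * norm (x - y) powr - (b + 4))) \<partial>lborel)"
      by (intro Bochner_Integration.integral_cong) (auto simp: algebra_simps)
    ultimately show ?thesis using int0 int2[OF i] by simp
  qed
  \<comment> \<open>Summation over the n coordinates turns the squares into |x - y|^2. Hence n * I =
    (b + 2) * I, and n < b + 2 forces I = 0.\<close>
  have "DIM('a) * ?I = (\<Sum>i\<in>(Basis::'a set). ?I)" by simp
  also have "\<dots> = (\<Sum>i\<in>Basis. (b + 2) * (\<integral>y. q y * (((x - y) \<bullet> i)\<^sup>2 * norm (x - y) powr - (b + 4)) \<partial>lborel))"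
    by (rule sum.cong[OF refl second])
  also have "\<dots> = (b + 2) * (\<integral>y. (\<Sum>i\<in>Basis. q y * (((x - y) \<bullet> i)\<^sup>2 * norm (x - y) powr - (b + 4))) \<partial>lborel)"
    using int2 by (simp add: sum_distrib_left)
  also have "(\<lambda>y. \<Sum>i\<in>Basis. q y * (((x - y) \<bullet> i)\<^sup>2 * norm (x - y) powr - (b + 4)))
     = (\<lambda>y. q y * norm (x - y) powr - (b + 2))"
  proof
    fix y
    have "(\<Sum>i\<in>Basis. q y * (((x - y) \<bullet> i)\<^sup>2 * norm (x - y) powr - (b + 4)))
      = q y * ((\<Sum>i\<in>Basis. ((x - y) \<bullet> i)\<^sup>2) * norm (x - y) powr - (b + 4))"
      by (simp add: sum_distrib_left sum_distrib_right)
    also have "(\<Sum>i\<in>Basis. ((x - y) \<bullet> i)\<^sup>2) = norm (x - y) * norm (x - y)"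
      by (simp add: power2_norm_eq_inner euclidean_inner[of "x - y" "x - y"] flip: power2_eq_square)
    also have "norm (x - y) * norm (x - y) * norm (x - y) powr - (b + 4) = norm (x - y) powr - (b + 2)"
      unfolding mult.assoc norm_powr_mult_self
      by (rule arg_cong[where f = "\<lambda>p. norm (x - y) powr p"]) simp
    finally show "(\<Sum>i\<in>Basis. q y * (((x - y) \<bullet> i)\<^sup>2 * norm (x - y) powr - (b + 4)))
      = q y * norm (x - y) powr - (b + 2)" .
  qed
  finally have "(DIM('a) - (b + 2)) * ?I = 0" by (simp add: algebra_simps)
  then show I: "?I = 0" using bn by auto
  assume i: "i \<in> Basis"
  have int1: "integrable lborel (\<lambda>y. q y * ?G i (x - y))"
    by (rule kernel_integrable[OF x, where e = 1 and D = 1]) (use G_bound[OF i] in auto)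
  \<comment> \<open>Write (y - x0) \<bullet> i = (x - x0) \<bullet> i - (x - y) \<bullet> i: the
    first part contributes a multiple of I, the second is the first derivative already known to
    vanish.\<close>
  have "(\<integral>y. (q y * ((y - x0) \<bullet> i)) * norm (x - y) powr - (b + 2) \<partial>lborel)
    = (\<integral>y. ((x - x0) \<bullet> i) * (q y * norm (x - y) powr - (b + 2)) - q y * ?G i (x - y) \<partial>lborel)"
    by (intro Bochner_Integration.integral_cong) (auto simp: algebra_simps inner_diff_left)
  also have "\<dots> = 0" using int0 int1 I first[OF i x] by simp
  finally show "(\<integral>y. (q y * ((y - x0) \<bullet> i)) * norm (x - y) powr - (b + 2) \<partial>lborel) = 0" .
qed

end

text \<open>Coordinates are appended one at a time, matching the single factor that each application
  of \<open>potential_step\<close> produces. The degree is an index because it governs both the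
  exponent of the kernel and the homogeneity.\<close>

inductive monom_fun :: "nat \<Rightarrow> ('a::euclidean_space \<Rightarrow> real) \<Rightarrow> bool" where
  one: "monom_fun 0 (\<lambda>_. 1)"
| step: "monom_fun d g \<Longrightarrow> i \<in> Basis \<Longrightarrow> monom_fun (Suc d) (\<lambda>z. g z * (z \<bullet> i))"

lemma monom_fun_mult:
  assumes "monom_fun d g" "monom_fun e h"
  shows "monom_fun (d + e) (\<lambda>z. g z * h z)"
  using assms
proof (induction d g rule: monom_fun.induct)
  case (step d g i)
  then have "monom_fun (Suc (d + e)) (\<lambda>z. (g z * h z) * (z \<bullet> i))"
    by (intro monom_fun.step) auto
  then show ?case by (simp add: mult_ac)
qed simp

lemma monom_fun_continuous: "monom_fun d g \<Longrightarrow> continuous_on UNIV g"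
  by (induction d g rule: monom_fun.induct) (auto intro!: continuous_intros)

lemma monom_fun_bound: "monom_fun d g \<Longrightarrow> \<bar>g z\<bar> \<le> norm z ^ d"
proof (induction d g rule: monom_fun.induct)
  case (step d g i)
  then have "\<bar>g z\<bar> * \<bar>z \<bullet> i\<bar> \<le> norm z ^ d * norm z" by (intro mult_mono Basis_le_norm) auto
  then show ?case by (simp add: abs_mult mult_ac)
qed simp

lemma monom_fun_scaleR: "monom_fun d g \<Longrightarrow> g (c *\<^sub>R z) = c ^ d * g z"
  by (induction d g rule: monom_fun.induct) (simp_all add: mult_ac)

text \<open>These are the polynomials, presented as sums of scaled monomials: the form in which a
  linear functional that vanishes on monomials is seen to vanish on all of them.\<close>

inductive monom_span :: "('a::euclidean_space \<Rightarrow> real) \<Rightarrow> bool" where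
  base: "monom_fun d g \<Longrightarrow> monom_span (\<lambda>z. c * g z)"
| add: "monom_span f \<Longrightarrow> monom_span g \<Longrightarrow> monom_span (\<lambda>z. f z + g z)"

lemma monom_span_const: "monom_span (\<lambda>z. c)"
  using monom_span.base[OF monom_fun.one, of c] by simp

lemma monom_span_mult:
  assumes "monom_span f" "monom_span g"
  shows "monom_span (\<lambda>z. f z * g z)"
  using assms
proof (induction f rule: monom_span.induct)
  case (base d f c)
  note f = base(1)
  from base(2) show ?case
  proof (induction g rule: monom_span.induct)
    case (base e g c')
    have "monom_span (\<lambda>z. (c * c') * (f z * g z))"
      by (rule monom_span.base[OF monom_fun_mult[OF f base]])
    then show ?case by (simp add: mult_ac)
  next
    case (add g h)
    then show ?case using monom_span.add[of "\<lambda>z. c * f z * g z" "\<lambda>z. c * f z * h z"] by (simp add: algebra_simps)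
  qed
next
  case (add f h)
  then show ?case using monom_span.add[of "\<lambda>z. f z * g z" "\<lambda>z. h z * g z"] by (simp add: algebra_simps)
qed

lemma monom_span_sum:
  "finite I \<Longrightarrow> (\<And>i. i \<in> I \<Longrightarrow> monom_span (f i)) \<Longrightarrow> monom_span (\<lambda>z. \<Sum>i\<in>I. f i z)"
  by (induction I rule: finite_induct) (auto intro: monom_span_const monom_span.add)

lemma monom_span_real_polynomial_function:
  "real_polynomial_function p \<Longrightarrow> monom_span p"
proof (induction p rule: real_polynomial_function.induct)
  case (linear f)
  have "f = (\<lambda>z. \<Sum>i\<in>Basis. f i * (1 * (z \<bullet> i)))"
  proof
    fix z
    interpret bounded_linear f by (rule linear)
    have "f z = f (\<Sum>i\<in>Basis. (z \<bullet> i) *\<^sub>R i)" by (simp add: euclidean_representation)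
    then show "f z = (\<Sum>i\<in>Basis. f i * (1 * (z \<bullet> i)))" by (simp add: sum scaleR mult_ac)
  qed
  moreover have "monom_span (\<lambda>z. \<Sum>i\<in>Basis. f i * (1 * (z \<bullet> i)))"
    by (intro monom_span_sum monom_span.base[OF monom_fun.step[OF monom_fun.one]]) auto
  ultimately show ?case by simp
qed (auto intro: monom_span_const monom_span.add monom_span_mult)

text \<open>The set where f is nonzero is open, and a nonempty open set is not negligible. This
  promotes the almost everywhere identities obtained from test functions to pointwise ones.\<close>

lemma continuous_AE_eq_0_imp_eq_0:
  fixes f :: "'a::euclidean_space \<Rightarrow> real"
  assumes U: "open U" and f: "continuous_on U f"
    and ae: "AE x in lebesgue. x \<in> U \<longrightarrow> f x = 0" and x: "x \<in> U"
  shows "f x = 0"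
proof (rule ccontr)
  assume "f x \<noteq> 0"
  define V where "V = U \<inter> f -` (- {0})"
  have "open V" unfolding V_def using f U by (intro continuous_open_preimage) auto
  moreover have "x \<in> V" using x \<open>f x \<noteq> 0\<close> by (simp add: V_def)
  ultimately have "\<not> negligible V" using open_not_negligible by blast
  moreover have "V \<in> null_sets lebesgue"
  proof -
    have "V \<in> sets lebesgue" using \<open>open V\<close> by (simp add: lmeasurable_open borel_open)
    moreover have "AE x in lebesgue. x \<notin> V" using ae by eventually_elim (auto simp: V_def)
    ultimately show ?thesis by (simp add: AE_iff_null_sets)
  qed
  ultimately show False by (simp add: negligible_iff_null_sets)
qed

section \<open>The Kelvin transform and density of polynomials\<close>

context
  fixes x0 :: "'a::euclidean_space" and r \<sigma> B :: real and v :: "'a \<Rightarrow> real"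
  assumes r: "0 < r" and \<sigma>: "0 < \<sigma>" and v_cont: "continuous_on UNIV v"
    and v_zero: "\<And>y. y \<in> ball x0 r \<Longrightarrow> v y = 0" and v_bound: "\<And>y. \<bar>v y\<bar> \<le> B"
    and potential_zero: "\<And>x. x \<in> ball x0 r \<Longrightarrow>
       (\<integral>y. v y * norm (x - y) powr - (DIM('a) + \<sigma>) \<partial>lborel) = 0"
begin

text \<open>Each coordinate factor costs two powers of the kernel, so induction on the degree
  applies \<open>potential_step\<close> with b = n + \<sigma> + 2 * d to the density
  \<open>v y * g (y - x0)\<close>.\<close>

lemma potential_monom_eq_0:
  assumes "monom_fun d g" "x \<in> ball x0 (r/2)"
  shows "(\<integral>y. (v y * g (y - x0)) * norm (x - y) powr - (DIM('a) + \<sigma> + 2 * d) \<partial>lborel) = 0"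
  using assms
proof (induction d g arbitrary: x rule: monom_fun.induct)
  case one
  then show ?case using potential_zero[of x] r by simp
next
  case (step d g i)
  have [measurable]: "v \<in> borel_measurable borel" "g \<in> borel_measurable borel"
    using v_cont monom_fun_continuous[OF step(1)] by (auto intro: borel_measurable_continuous_onI)
  have bound: "\<bar>v y * g (y - x0)\<bar> \<le> (B * r powr - d) *
      norm (y - x0) powr ((DIM('a) + \<sigma> + 2 * d) - DIM('a) - \<sigma>)" for y
  proof (cases "y \<in> ball x0 r")
    case True
    have "0 \<le> B" using v_bound[of x0] by linarith
    then show ?thesis using v_zero[OF True] by simp
  next
    case False
    then have y: "r \<le> norm (y - x0)" by (simp add: dist_norm norm_minus_commute)
    then have pos: "0 < norm (y - x0)" using r by linarith
    have B: "0 \<le> B" using v_bound[of x0] by linarith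
    have "\<bar>v y * g (y - x0)\<bar> \<le> B * norm (y - x0) powr d"
      unfolding abs_mult using v_bound[of y] monom_fun_bound[OF step(1), of "y - x0"] pos B
      by (intro mult_mono) (auto simp: powr_realpow)
    \<comment> \<open>The density grows only to order d, while the required form of the bound has
      order b - n - \<sigma> = 2 * d. Since |y - x0| >= r off the ball, the d additional powers cost
      the constant r^(-d).\<close>
    also have "norm (y - x0) powr d = norm (y - x0) powr - d * norm (y - x0) powr (2 * d)"
      unfolding powr_add[symmetric] by (rule arg_cong[where f = "\<lambda>p. norm (y - x0) powr p"]) simp
    also have "B * \<dots> \<le> B * (r powr - d * norm (y - x0) powr (2 * d))"
      using B y r by (intro mult_left_mono mult_right_mono powr_mono2') auto
    finally show ?thesis by (simp add: mult_ac)
  qed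
  have "(\<integral>y. (v y * g (y - x0) * ((y - x0) \<bullet> i)) * norm (x - y) powr - (DIM('a) + \<sigma> + 2 * d + 2) \<partial>lborel) = 0"
    by (rule potential_step(2)[OF r \<sigma> _ _ _ bound])
       (use step \<sigma> v_zero DIM_positive[where 'a='a] in auto)
  then show ?case by (simp add: algebra_simps)
qed

text \<open>Inversion in the unit sphere about x0, recentred at the origin; it maps the complement
  of \<open>ball x0 r\<close> into the closed ball of radius 1 / r.\<close>

definition "kelvin y = (1 / (norm (y - x0))\<^sup>2) *\<^sub>R (y - x0)"
text \<open>The kernel frozen at x = x0. It has finite mass off the ball, so uniform approximation
  controls the integrals.\<close>

definition "weight y = norm (x0 - y) powr - (DIM('a) + \<sigma>)"

lemma norm_kelvin: "norm (kelvin y) = 1 / norm (y - x0)"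
  by (simp add: kelvin_def power2_eq_square)

lemma integrable_weight: "integrable lborel (\<lambda>y. indicator (- ball x0 r) y * weight y)"
  using integrable_kernel_outside_ball[OF \<sigma> r, of x0] by (simp add: weight_def dist_norm)

lemma integrable_mult_weight:
  assumes [measurable]: "h \<in> borel_measurable borel" and h: "\<And>y. y \<notin> ball x0 r \<Longrightarrow> \<bar>h y\<bar> \<le> D"
  shows "integrable lborel (\<lambda>y. v y * h y * weight y)"
    and "\<bar>\<integral>y. v y * h y * weight y \<partial>lborel\<bar> \<le> D * (B * (\<integral>y. indicator (- ball x0 r) y * weight y \<partial>lborel))"
proof -
  have [measurable]: "v \<in> borel_measurable borel" 
    using v_cont by (auto intro: borel_measurable_continuous_onI)
  have [measurable]: "weight \<in> borel_measurable borel" unfolding weight_def by measurable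
  have le: "\<bar>v y * h y * weight y\<bar> \<le> D * (B * (indicator (- ball x0 r) y * weight y))" for y
  proof (cases "y \<in> ball x0 r")
    case False
    have "\<bar>v y * h y * weight y\<bar> \<le> B * D * weight y"
      unfolding abs_mult using v_bound[of y] h[OF False] by (intro mult_mono) (auto simp: weight_def)
    then show ?thesis using False by (simp add: mult_ac)
  qed (simp add: v_zero)
  have int: "integrable lborel (\<lambda>y. D * (B * (indicator (- ball x0 r) y * weight y)))"
    by (intro integrable_mult_right integrable_weight)
  show *: "integrable lborel (\<lambda>y. v y * h y * weight y)"
    by (rule Bochner_Integration.integrable_bound[OF int])
       (use le in \<open>auto intro!: AE_I2 order_trans[OF _ abs_ge_self]\<close>)
  have "\<bar>\<integral>y. v y * h y * weight y \<partial>lborel\<bar> \<le> (\<integral>y. \<bar>v y * h y * weight y\<bar> \<partial>lborel)"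
    by (rule integral_abs_bound)
  also have "\<dots> \<le> (\<integral>y. D * (B * (indicator (- ball x0 r) y * weight y)) \<partial>lborel)"
    by (intro integral_mono int) (use le * in auto)
  finally show "\<bar>\<integral>y. v y * h y * weight y \<partial>lborel\<bar> \<le> D * (B * (\<integral>y. indicator (- ball x0 r) y * weight y \<partial>lborel))"
    by simp
qed

lemma kelvin_measurable[measurable]: "kelvin \<in> borel_measurable borel"
  unfolding kelvin_def by measurable

text \<open>By homogeneity g (kelvin y) = |y - x0|^(-2 d) * g (y - x0) for a monomial of degree d,
  and this factor is precisely the extra decay gained in d steps. Linearity extends the identity to
  all polynomials.\<close>

lemma integral_kelvin_eq_0:
  assumes "monom_span p"
  shows "integrable lborel (\<lambda>y. v y * p (kelvin y) * weight y) \<and> (\<integral>y. v y * p (kelvin y) * weight y \<partial>lborel) = 0"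
  using assms
proof (induction p rule: monom_span.induct)
  case (base d g c)
  have [measurable]: "g \<in> borel_measurable borel"
    using monom_fun_continuous[OF base] by (auto intro: borel_measurable_continuous_onI)
  have "integrable lborel (\<lambda>y. v y * g (kelvin y) * weight y)"
  proof (rule integrable_mult_weight)
    fix y assume "y \<notin> ball x0 r"
    then have "norm (kelvin y) \<le> 1 / r" using r
      unfolding norm_kelvin by (intro divide_left_mono mult_pos_pos) (auto simp: dist_norm norm_minus_commute)
    then show "\<bar>g (kelvin y)\<bar> \<le> (1 / r) ^ d"
      by (intro order_trans[OF monom_fun_bound[OF base]] power_mono) auto
  qed measurable
  moreover have "(\<integral>y. v y * g (kelvin y) * weight y \<partial>lborel)
    = (\<integral>y. (v y * g (y - x0)) * norm (x0 - y) powr - (DIM('a) + \<sigma> + 2 * d) \<partial>lborel)"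
  proof (rule Bochner_Integration.integral_cong[OF refl])
    fix y
    show "v y * g (kelvin y) * weight y = (v y * g (y - x0)) * norm (x0 - y) powr - (DIM('a) + \<sigma> + 2 * d)"
    proof (cases "y \<in> ball x0 r")
      case False
      then have pos: "0 < norm (y - x0)" using r by auto
      have "norm (x0 - y) powr - (DIM('a) + \<sigma> + 2 * d) = weight y * norm (x0 - y) powr - (2 * d)"
        unfolding weight_def powr_add[symmetric] by (rule arg_cong[where f = "\<lambda>p. norm (x0 - y) powr p"]) simp
      also have "norm (x0 - y) powr - (2 * d) = (1 / (norm (y - x0))\<^sup>2) ^ d"
        using pos by (simp add: powr_minus_divide powr_realpow[symmetric] power_one_over norm_minus_commute powr_powr
            flip: powr_numeral)
      finally show ?thesis by (simp add: kelvin_def monom_fun_scaleR[OF base])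
    qed (simp add: v_zero)
  qed
  ultimately show ?case using potential_monom_eq_0[OF base, of x0] r
    by (simp add: mult.left_commute[of _ c] mult.assoc)
next
  case (add f g)
  then show ?case by (simp add: algebra_simps)
qed

lemma potential_zero_imp_zero: "v y = 0"
proof -
  \<comment> \<open>As z tends to 0 the argument of v runs off to infinity; the factor |z| and the
    bound on v make h continuous there. Moreover h (kelvin y) = v y / |y - x0| has the sign of v y,
    so the integrand of I below is nonnegative.\<close>
  define h where "h z = v (x0 + (1 / (norm z)\<^sup>2) *\<^sub>R z) * norm z" for z
  have B: "0 \<le> B" using v_bound[of x0] by linarith
  have h_cont: "continuous_on UNIV h"
  proof -
    have "isCont h z" for z
    proof (cases "z = 0")
      case True
      have "(h \<longlongrightarrow> 0) (at 0)"
      proof (rule Lim_null_comparison)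
        show "\<forall>\<^sub>F z in at 0. norm (h z) \<le> B * norm z"
          using v_bound by (auto simp: h_def abs_mult intro!: always_eventually mult_right_mono)
        show "((\<lambda>z::'a. B * norm z) \<longlongrightarrow> 0) (at 0)" by (auto intro!: tendsto_eq_intros)
      qed
      then show ?thesis using True by (simp add: isCont_def h_def)
    next
      case False
      have "isCont v w" for w using v_cont by (simp add: continuous_on_eq_continuous_at)
      moreover have "isCont (\<lambda>z. x0 + (1 / (norm z)\<^sup>2) *\<^sub>R z) z"
        using False by (intro continuous_intros) auto
      ultimately have "isCont (\<lambda>z. v (x0 + (1 / (norm z)\<^sup>2) *\<^sub>R z)) z"
        by (rule isCont_o2[rotated])
      then show ?thesis unfolding h_def by (intro continuous_mult continuous_norm continuous_ident)
    qed
    then show ?thesis by (simp add: continuous_on_eq_continuous_at)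
  qed
  have [measurable]: "h \<in> borel_measurable borel"
    using h_cont by (rule borel_measurable_continuous_onI)
  have h_kelvin: "h (kelvin y) = v y / norm (y - x0)" if "y \<noteq> x0" for y
  proof -
    have "x0 + (1 / (norm (kelvin y))\<^sup>2) *\<^sub>R kelvin y = y"
      using that unfolding norm_kelvin by (simp add: kelvin_def power_divide)
    then show ?thesis by (simp add: h_def norm_kelvin)
  qed
  have far: "norm (kelvin y) \<le> 1 / r" if "y \<notin> ball x0 r" for y
    using r that unfolding norm_kelvin
    by (intro divide_left_mono mult_pos_pos) (auto simp: dist_norm norm_minus_commute)
  define I where "I = (\<integral>y. v y * h (kelvin y) * weight y \<partial>lborel)"
  define D where "D = B * (\<integral>y. indicator (- ball x0 r) y * weight y \<partial>lborel)"
  have int: "integrable lborel (\<lambda>y. v y * h (kelvin y) * weight y)"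
  proof (rule integrable_mult_weight(1))
    fix y assume y: "y \<notin> ball x0 r"
    have "\<bar>h (kelvin y)\<bar> \<le> B * norm (kelvin y)"
      using v_bound by (auto simp: h_def abs_mult intro!: mult_right_mono)
    also have "\<dots> \<le> B * (1 / r)" using far[OF y] B by (intro mult_left_mono) auto
    finally show "\<bar>h (kelvin y)\<bar> \<le> B * (1 / r)" .
  qed measurable
  \<comment> \<open>Replacing h by h - p leaves I unchanged, because polynomials integrate to 0, and
    h - p is uniformly below e on the ball that contains all Kelvin images of points where v is
    nonzero.\<close>
  have small: "\<bar>I\<bar> \<le> e * D" if "0 < e" for e
  proof -
    obtain p where p: "real_polynomial_function p" "\<And>z. z \<in> cball 0 (1/r) \<Longrightarrow> \<bar>h z - p z\<bar> < e"
      using Stone_Weierstrass_real_polynomial_function[of "cball 0 (1/r)" h e] h_cont \<open>0 < e\<close>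
        continuous_on_subset by (metis compact_cball subset_UNIV)
    have "continuous_on UNIV p"
      using p(1) by (simp add: real_polynomial_function_eq continuous_on_polymonial_function)
    then have [measurable]: "p \<in> borel_measurable borel" by (rule borel_measurable_continuous_onI)
    note z = integral_kelvin_eq_0[OF monom_span_real_polynomial_function[OF p(1)]]
    have "I = (\<integral>y. v y * (h (kelvin y) - p (kelvin y)) * weight y \<partial>lborel)"
      unfolding I_def using z int by (simp add: algebra_simps)
    also have "\<bar>\<dots>\<bar> \<le> e * D"
      unfolding D_def by (rule integrable_mult_weight(2)) (use p(2) far in \<open>auto intro: less_imp_le\<close>)
    finally show ?thesis .
  qed
  have "I \<le> 0"
  proof (rule field_le_epsilon)
    fix e :: real assume "0 < e"
    show "I \<le> 0 + e"
    proof (cases "D > 0")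
      case True
      then show ?thesis using small[of "e / D"] \<open>0 < e\<close> by simp
    next
      case False
      then show ?thesis using small[of 1] \<open>0 < e\<close> by simp
    qed
  qed
  have nonneg: "0 \<le> v y * h (kelvin y) * weight y" for y
  proof (cases "y = x0")
    case False
    then have "v y * h (kelvin y) * weight y = (v y)\<^sup>2 / norm (y - x0) * weight y"
      by (simp add: h_kelvin power2_eq_square)
    then show ?thesis by (simp add: weight_def)
  qed (simp add: v_zero r)
  have "0 \<le> I" unfolding I_def by (rule Bochner_Integration.integral_nonneg) (rule nonneg)
  then have "I = 0" using \<open>I \<le> 0\<close> by simp
  then have "AE y in lborel. v y * h (kelvin y) * weight y = 0"
    using integral_nonneg_eq_0_iff_AE[OF int] nonneg by (simp add: I_def)
  then have "AE y in lborel. v y = 0"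
  proof eventually_elim
    case (elim y)
    show ?case
    proof (cases "y = x0")
      case False
      then show ?thesis using elim by (simp add: h_kelvin weight_def)
    qed (simp add: v_zero r)
  qed
  then have "AE y in lebesgue. y \<in> UNIV \<longrightarrow> v y = 0" by (auto simp: AE_completion)
  then show "v y = 0"
    using continuous_AE_eq_0_imp_eq_0[OF open_UNIV v_cont] by blast
qed

end

section \<open>The fundamental lemma of the calculus of variations\<close>

definition C1_fun :: "('a::euclidean_space \<Rightarrow> real) \<Rightarrow> bool" where
  "C1_fun \<phi> \<longleftrightarrow> (\<exists>\<phi>' :: 'a \<Rightarrow> 'a \<Rightarrow>\<^sub>L real.
     (\<forall>x. (\<phi> has_derivative blinfun_apply (\<phi>' x)) (at x)) \<and> continuous_on UNIV \<phi>')"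

lemma C1_fun_continuous: "C1_fun \<phi> \<Longrightarrow> continuous_on UNIV \<phi>"
  unfolding C1_fun_def by (meson continuous_at_imp_continuous_on has_derivative_continuous)

lemma C1_fun_const: "C1_fun (\<lambda>x. c)"
  unfolding C1_fun_def by (intro exI[of _ "\<lambda>x. 0"]) (auto simp: zero_blinfun.rep_eq)

lemma C1_fun_inner: "C1_fun (\<lambda>x. (x - l) \<bullet> i)"
  unfolding C1_fun_def
  by (intro exI[of _ "\<lambda>x. blinfun_inner_left i"]) (auto intro!: derivative_eq_intros)

lemma C1_fun_mult:
  assumes "C1_fun f" "C1_fun g"
  shows "C1_fun (\<lambda>x. f x * g x)"
proof -
  obtain f' g' where *: "\<And>x. (f has_derivative blinfun_apply (f' x)) (at x)" "continuous_on UNIV f'"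
    "\<And>x. (g has_derivative blinfun_apply (g' x)) (at x)" "continuous_on UNIV g'"
    using assms unfolding C1_fun_def by blast
  have "((\<lambda>x. f x * g x) has_derivative blinfun_apply (f x *\<^sub>R g' x + g x *\<^sub>R f' x)) (at x)" for x
    using has_derivative_mult[OF *(1)[of x] *(3)[of x]]
    by (simp add: plus_blinfun.rep_eq scaleR_blinfun.rep_eq mult.commute)
  then show ?thesis unfolding C1_fun_def
    by (intro exI[of _ "\<lambda>x. f x *\<^sub>R g' x + g x *\<^sub>R f' x"])
       (use * C1_fun_continuous assms in \<open>auto intro!: continuous_intros\<close>)
qed

lemma C1_fun_compose:
  assumes f: "C1_fun f" and p: "\<And>t. (p has_real_derivative p' t) (at t)" "continuous_on UNIV p'"
  shows "C1_fun (\<lambda>x. p (f x))"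
proof -
  obtain f' where *: "\<And>x. (f has_derivative blinfun_apply (f' x)) (at x)" "continuous_on UNIV f'"
    using f unfolding C1_fun_def by blast
  have "((\<lambda>x. p (f x)) has_derivative blinfun_apply (p' (f x) *\<^sub>R f' x)) (at x)" for x
    using has_derivative_compose[OF *(1)[of x] p(1)[of "f x", unfolded has_field_derivative_def]]
    by (simp add: scaleR_blinfun.rep_eq)
  moreover have "continuous_on UNIV (\<lambda>x. p' (f x))"
    using continuous_on_compose2[OF p(2) C1_fun_continuous[OF f]] by simp
  ultimately show ?thesis unfolding C1_fun_def
    by (intro exI[of _ "\<lambda>x. p' (f x) *\<^sub>R f' x"]) (use * in \<open>auto intro!: continuous_intros\<close>)
qed

lemma C1_fun_prod:
  "finite I \<Longrightarrow> (\<And>i. i \<in> I \<Longrightarrow> C1_fun (f i)) \<Longrightarrow> C1_fun (\<lambda>x. \<Prod>i\<in>I. f i x)"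
  by (induction I rule: finite_induct) (auto intro: C1_fun_const C1_fun_mult)

lemma test_fun_iff_C1_fun:
  "test_fun \<Omega> \<phi> \<longleftrightarrow> C1_fun \<phi> \<and> compact (closure {x. \<phi> x \<noteq> 0}) \<and> closure {x. \<phi> x \<noteq> 0} \<subseteq> \<Omega>"
  unfolding test_fun_def C1_fun_def by blast

text \<open>At 0 the difference quotient is at most |h|, so the two one-sided formulas join to a C^1
  function, which is the regularity that \<open>test_fun\<close> demands.\<close>

lemma DERIV_max_0_square: "((\<lambda>t. (max 0 t)\<^sup>2) has_real_derivative 2 * max 0 t) (at t)"
proof (cases "t = 0")
  case True
  have "((\<lambda>h::real. ((max 0 (0 + h))\<^sup>2 - (max 0 0)\<^sup>2) / h) \<longlongrightarrow> 0) (at 0)"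
  proof (rule Lim_null_comparison)
    show "\<forall>\<^sub>F h in at 0. norm (((max 0 (0 + h))\<^sup>2 - (max 0 (0::real))\<^sup>2) / h) \<le> \<bar>h\<bar>"
      by (auto intro!: always_eventually simp: max_def power2_eq_square)
  qed (auto intro!: tendsto_eq_intros)
  then show ?thesis using True by (simp add: DERIV_def)
next
  case False
  show ?thesis
  proof (cases "t > 0")
    case True
    have "((\<lambda>t::real. t\<^sup>2) has_real_derivative 2 * t) (at t)" by (auto intro!: derivative_eq_intros)
    then have "((\<lambda>t. (max 0 t)\<^sup>2) has_real_derivative 2 * t) (at t)"
      by (rule has_field_derivative_transform_within_open[where S = "{0<..}"]) (use True in auto)
    then show ?thesis using True by simp
  next
    case 2: False
    have "((\<lambda>t::real. 0) has_real_derivative 0) (at t)" by simp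
    then have "((\<lambda>t. (max 0 t)\<^sup>2) has_real_derivative 0) (at t)"
      by (rule has_field_derivative_transform_within_open[where S = "{..<0}"]) (use False 2 in auto)
    then show ?thesis using 2 by simp
  qed
qed

text \<open>The upper faces are written with (x - u) \<bullet> (- i) so that every factor is the
  squared positive part of a function covered by \<open>C1_fun_inner\<close>.\<close>

definition box_bump :: "'a::euclidean_space \<Rightarrow> 'a \<Rightarrow> 'a \<Rightarrow> real" where
  "box_bump l u x = (\<Prod>i\<in>Basis. (max 0 ((x - l) \<bullet> i))\<^sup>2 * (max 0 ((x - u) \<bullet> (- i)))\<^sup>2)"

lemma C1_fun_box_bump: "C1_fun (box_bump l u)"
  unfolding box_bump_def
  by (intro C1_fun_prod C1_fun_mult C1_fun_compose[OF C1_fun_inner DERIV_max_0_square] continuous_intros) auto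

lemma box_bump_nonneg: "0 \<le> box_bump l u x"
  unfolding box_bump_def by (intro prod_nonneg) auto

lemma box_bump_pos_iff: "0 < box_bump l u x \<longleftrightarrow> x \<in> box l u"
proof -
  have "0 < box_bump l u x \<longleftrightarrow> box_bump l u x \<noteq> 0" using box_bump_nonneg[of l u x] by linarith
  also have "\<dots> \<longleftrightarrow> x \<in> box l u"
    unfolding box_bump_def mem_box by (force simp: inner_diff_left max_def)
  finally show ?thesis .
qed

text \<open>Composition with 1 - exp (- c t) keeps C^1 regularity and the support inside the box.
  For c >= 0 the values lie in [0, 1), and as c grows they tend to the indicator of the open
  box.\<close>

lemma test_fun_box_bump:
  assumes "cbox l u \<subseteq> \<Omega>"
  shows "test_fun \<Omega> (\<lambda>x. 1 - exp (- (c * box_bump l u x)))"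
proof -
  have "C1_fun (\<lambda>x. 1 - exp (- (c * box_bump l u x)))"
    by (rule C1_fun_compose[OF C1_fun_box_bump, where p = "\<lambda>t. 1 - exp (- (c * t))" and p' = "\<lambda>t. c * exp (- (c * t))"])
       (auto intro!: derivative_eq_intros continuous_intros)
  moreover have "{x. 1 - exp (- (c * box_bump l u x)) \<noteq> 0} \<subseteq> box l u"
    using box_bump_pos_iff[of l u] box_bump_nonneg[of l u] by (force simp: less_le)
  then have "closure {x. 1 - exp (- (c * box_bump l u x)) \<noteq> 0} \<subseteq> cbox l u"
    by (meson box_subset_cbox closed_cbox closure_minimal order_trans)
  moreover from this have "compact (closure {x. 1 - exp (- (c * box_bump l u x)) \<noteq> 0})"
    by (meson bounded_cbox bounded_subset closed_closure compact_eq_bounded_closed)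
  ultimately show ?thesis unfolding test_fun_iff_C1_fun using assms by auto
qed

lemma test_fun_continuous: "test_fun \<Omega> \<phi> \<Longrightarrow> continuous_on UNIV \<phi>"
  by (simp add: test_fun_iff_C1_fun C1_fun_continuous)

lemma integral_box_eq_0:
  fixes g :: "'a::euclidean_space \<Rightarrow> real"
  assumes [measurable]: "g \<in> borel_measurable borel" and bound: "\<And>x. \<bar>g x\<bar> \<le> B"
    and zero: "\<And>\<phi>. test_fun \<Omega> \<phi> \<Longrightarrow> (\<integral>x. g x * \<phi> x \<partial>lborel) = 0"
    and sub: "cbox l u \<subseteq> \<Omega>"
  shows "(\<integral>x. g x * indicator (box l u) x \<partial>lborel) = 0"
proof -
  define \<phi> where "\<phi> k x = 1 - exp (- (real k * box_bump l u x))" for k x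
  have test: "test_fun \<Omega> (\<phi> k)" for k unfolding \<phi>_def by (rule test_fun_box_bump[OF sub])
  then have [measurable]: "\<phi> k \<in> borel_measurable borel" for k
    by (intro borel_measurable_continuous_onI test_fun_continuous)
  have \<phi>_out: "\<phi> k x = 0" if "x \<notin> box l u" for k x
    using that box_bump_pos_iff[of l u x] box_bump_nonneg[of l u x] by (simp add: \<phi>_def)
  have \<phi>_bound: "0 \<le> \<phi> k x" "\<phi> k x \<le> 1" for k x
    using box_bump_nonneg[of l u x] by (auto simp: \<phi>_def)
  have "(\<lambda>k. \<integral>x. g x * \<phi> k x \<partial>lborel) \<longlonglongrightarrow> (\<integral>x. g x * indicator (box l u) x \<partial>lborel)"
  proof (rule integral_dominated_convergence[where w = "\<lambda>x. B * indicator (box l u) x"])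
    show "integrable lborel (\<lambda>x. B * indicator (box l u) x)"
      by (intro integrable_mult_right integrable_real_indicator) (use emeasure_lborel_box_finite[of l u] in auto)
    have "(\<lambda>k. g x * \<phi> k x) \<longlonglongrightarrow> g x * indicator (box l u) x" for x
    proof (cases "x \<in> box l u")
      case True
      then have "0 < box_bump l u x" by (simp add: box_bump_pos_iff)
      then have "(\<lambda>k. \<phi> k x) \<longlonglongrightarrow> 1" unfolding \<phi>_def by real_asymp
      then show ?thesis using True by (auto intro!: tendsto_eq_intros)
    qed (simp add: \<phi>_out)
    then show "AE x in lborel. (\<lambda>k. g x * \<phi> k x) \<longlonglongrightarrow> g x * indicator (box l u) x" by simp
    have "norm (g x * \<phi> k x) \<le> B * indicator (box l u) x" for k x
    proof (cases "x \<in> box l u")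
      case True
      then show ?thesis using bound[of x] \<phi>_bound[of k x] mult_mono[of "\<bar>g x\<bar>" B "\<phi> k x" 1]
        by (simp add: abs_mult)
    qed (simp add: \<phi>_out)
    then show "AE x in lborel. norm (g x * \<phi> k x) \<le> B * indicator (box l u) x" for k by simp
  qed measurable
  then show ?thesis
    using LIMSEQ_unique[OF _ tendsto_const] by (simp add: zero[OF test])
qed

text \<open>The boxes determine Lebesgue measure, so the measure with density
  \<open>1 + g / (2 * B)\<close> on a box is Lebesgue measure.\<close>
lemma AE_box_eq_0:
  fixes g :: "'a::euclidean_space \<Rightarrow> real"
  assumes [measurable]: "g \<in> borel_measurable borel" and bound: "\<And>x. \<bar>g x\<bar> \<le> B" and "0 < B"
    and zero: "\<And>l u. cbox l u \<subseteq> \<Omega> \<Longrightarrow> (\<integral>x. g x * indicator (box l u) x \<partial>lborel) = 0"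
    and sub: "cbox l0 u0 \<subseteq> \<Omega>"
  shows "AE x in lborel. x \<in> box l0 u0 \<longrightarrow> g x = 0"
proof -
  \<comment> \<open>Dividing by 2 * B keeps the density at least 1 / 2, hence nonnegative.\<close>
  define h where "h x = 1 + g x * indicator (box l0 u0) x / (2 * B)" for x
  have [measurable]: "h \<in> borel_measurable borel" unfolding h_def by measurable
  have h0: "\<bar>g x * indicator (box l0 u0) x\<bar> \<le> B" for x
    using bound[of x] \<open>0 < B\<close> by (auto simp: indicator_def)
  have h: "0 \<le> h x" for x
    using h0[of x] \<open>0 < B\<close> by (simp add: h_def field_simps) 
  have "lborel = density lborel (\<lambda>x. ennreal (h x))"
  proof (rule lborel_eqI)
    fix l u :: 'a assume lu: "\<And>b. b \<in> Basis \<Longrightarrow> l \<bullet> b \<le> u \<bullet> b"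
    obtain l' u' where *: "box l u \<inter> box l0 u0 = box l' u'" by (simp add: box_Int_box)
    have "(\<integral>x. g x * indicator (box l u \<inter> box l0 u0) x \<partial>lborel) = 0"
    \<comment> \<open>An empty open box is treated apart, since its closed version can be a nonempty
      degenerate box outside \<Omega>; a nonempty open box is dense in its closed version.\<close>
    proof (cases "box l' u' = {}")
      case False
      then have "cbox l' u' = closure (box l' u')" by (simp add: closure_box)
      also have "\<dots> \<subseteq> cbox l0 u0"
        by (metis * Int_lower2 box_subset_cbox closed_cbox closure_minimal order_trans)
      finally show ?thesis unfolding * using sub by (intro zero) auto
    qed (simp add: *)
    moreover have "integrable lborel (\<lambda>x. g x * indicator (box l u \<inter> box l0 u0) x)"
      unfolding *
    proof (rule Bochner_Integration.integrable_bound)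
      show "integrable lborel (\<lambda>x. B * indicator (box l' u') x)"
        by (intro integrable_mult_right integrable_real_indicator) (use emeasure_lborel_box_finite[of l' u'] in auto)
    qed (use bound \<open>0 < B\<close> in \<open>auto simp: indicator_def intro!: AE_I2\<close>)
    moreover have "integrable lborel (\<lambda>x. indicator (box l u) x :: real)"
      by (intro integrable_real_indicator) (use emeasure_lborel_box_finite[of l u] in auto)
    moreover have "h x * indicator (box l u) x
        = indicator (box l u) x + g x * indicator (box l u \<inter> box l0 u0) x / (2 * B)" for x
      by (simp add: h_def indicator_def)
    ultimately have "integrable lborel (\<lambda>x. h x * indicator (box l u) x)"
      "(\<integral>x. h x * indicator (box l u) x \<partial>lborel) = measure lborel (box l u)" by simp_all
    then have "(\<integral>\<^sup>+x. ennreal (h x * indicator (box l u) x) \<partial>lborel) = ennreal (measure lborel (box l u))"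
      using h by (subst nn_integral_eq_integral) auto
    also have "(\<integral>\<^sup>+x. ennreal (h x * indicator (box l u) x) \<partial>lborel)
       = emeasure (density lborel (\<lambda>x. ennreal (h x))) (box l u)"
      by (auto simp: emeasure_density indicator_def intro!: nn_integral_cong)
    also have "measure lborel (box l u) = (\<Prod>b\<in>Basis. (u - l) \<bullet> b)"
      using lu by (rule measure_lborel_box)
    finally show "emeasure (density lborel (\<lambda>x. ennreal (h x))) (box l u) = (\<Prod>b\<in>Basis. (u - l) \<bullet> b)" .
  qed simp
  then have "density lborel (\<lambda>x::'a. 1) = density lborel (\<lambda>x. ennreal (h x))" by (simp add: density_1)
  then have "AE x in lborel. (1::ennreal) = ennreal (h x)"
    by (intro sigma_finite_measure.density_unique[OF sigma_finite_lborel]) auto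
  then show ?thesis
    by eventually_elim (use \<open>0 < B\<close> in \<open>auto simp: h_def indicator_def\<close>)
qed

text \<open>An open set is a countable union of closed boxes, and the boundary of a box is null, so
  vanishing on open boxes is enough.\<close>

lemma fundamental_lemma_borel:
  fixes g :: "'a::euclidean_space \<Rightarrow> real"
  assumes "open \<Omega>" and g: "g \<in> borel_measurable borel" "\<And>x. \<bar>g x\<bar> \<le> B"
    and zero: "\<And>\<phi>. test_fun \<Omega> \<phi> \<Longrightarrow> (\<integral>x. g x * \<phi> x \<partial>lborel) = 0"
  shows "AE x in lborel. x \<in> \<Omega> \<longrightarrow> g x = 0"
proof -
  obtain \<D> where \<D>: "countable \<D>" "\<D> \<subseteq> Pow \<Omega>" "\<And>X. X \<in> \<D> \<Longrightarrow> \<exists>a b. X = cbox a b" "\<Union>\<D> = \<Omega>"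
    using open_countable_Union_open_cbox[OF \<open>open \<Omega>\<close>] by blast
  have cbox: "AE x in lborel. x \<in> cbox l u \<longrightarrow> g x = 0" if "cbox l u \<subseteq> \<Omega>" for l u
  proof -
    have "AE x in lborel. x \<in> box l u \<longrightarrow> g x = 0"
    proof (rule AE_box_eq_0[where B = "\<bar>B\<bar> + 1" and \<Omega> = \<Omega>])
      show "\<bar>g x\<bar> \<le> \<bar>B\<bar> + 1" for x using g(2)[of x] by linarith
      show "(\<integral>x. g x * indicator (box l u) x \<partial>lborel) = 0" if "cbox l u \<subseteq> \<Omega>" for l u
        by (rule integral_box_eq_0[OF g zero that])
    qed (use that g in auto)
    moreover have "AE x in lborel. x \<notin> cbox l u - box l u"
    proof -
      have "cbox l u - box l u \<in> null_sets lebesgue"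
        using negligible_frontier_interval negligible_iff_null_sets by blast
      then have "AE x in lebesgue. x \<notin> cbox l u - box l u" by (rule AE_not_in)
      then show ?thesis by (simp add: AE_completion_iff)
    qed
    ultimately show ?thesis by eventually_elim auto
  qed
  have "AE x in lborel. \<forall>X\<in>\<D>. x \<in> X \<longrightarrow> g x = 0"
  proof (rule AE_ball_countable'[OF _ \<D>(1)])
    fix X assume "X \<in> \<D>"
    then obtain l u where "X = cbox l u" "cbox l u \<subseteq> \<Omega>" using \<D>(2,3) by blast
    then show "AE x in lborel. x \<in> X \<longrightarrow> g x = 0" using cbox by simp
  qed
  then show ?thesis by eventually_elim (use \<D>(4) in blast)
qed

lemma fundamental_lemma:
  fixes g :: "'a::euclidean_space \<Rightarrow> real"
  assumes "open \<Omega>" and g: "g \<in> borel_measurable lebesgue" and bound: "AE x in lebesgue. \<bar>g x\<bar> \<le> B"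
    and zero: "\<And>\<phi>. test_fun \<Omega> \<phi> \<Longrightarrow> (\<integral>x. g x * \<phi> x \<partial>lebesgue) = 0"
  shows "AE x in lebesgue. x \<in> \<Omega> \<longrightarrow> g x = 0"
proof -
  obtain g0 where [measurable]: "g0 \<in> borel_measurable lborel" and g0: "AE x in lborel. g x = g0 x"
    using completion_ex_borel_measurable_real[OF g] by blast
  \<comment> \<open>Clipping the Borel representative turns the almost everywhere bound into one
    valid at every point, and changes it only on a null set.\<close>
  define g1 where "g1 x = max (- \<bar>B\<bar>) (min \<bar>B\<bar> (g0 x))" for x
  have g1_meas[measurable]: "g1 \<in> borel_measurable borel" unfolding g1_def by measurable
  have eq: "AE x in lebesgue. g x = g1 x"
    using AE_completion[OF g0] bound
    by eventually_elim (auto simp: g1_def max_def min_def abs_if split: if_splits)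
  have "AE x in lborel. x \<in> \<Omega> \<longrightarrow> g1 x = 0"
  proof (rule fundamental_lemma_borel[OF \<open>open \<Omega>\<close> g1_meas])
    show "\<bar>g1 x\<bar> \<le> \<bar>B\<bar>" for x by (auto simp: g1_def)
    fix \<phi> assume \<phi>: "test_fun \<Omega> \<phi>"
    have [measurable]: "\<phi> \<in> borel_measurable borel"
      by (intro borel_measurable_continuous_onI test_fun_continuous[OF \<phi>])
    have m: "(\<lambda>x. g1 x * \<phi> x) \<in> borel_measurable lborel" by measurable
    have m1: "(\<lambda>x. g1 x * \<phi> x) \<in> borel_measurable lebesgue"
      using m by (rule measurable_completion)
    have m2: "(\<lambda>x. g x * \<phi> x) \<in> borel_measurable lebesgue"
      by (rule borel_measurable_times[OF g measurable_completion]) simp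
    have "(\<integral>x. g1 x * \<phi> x \<partial>lborel) = (\<integral>x. g1 x * \<phi> x \<partial>lebesgue)"
      using integral_completion[OF m] by simp
    also have "\<dots> = (\<integral>x. g x * \<phi> x \<partial>lebesgue)"
      by (rule integral_cong_AE[OF m1 m2]) (use eq in eventually_elim, simp)
    finally show "(\<integral>x. g1 x * \<phi> x \<partial>lborel) = 0" using zero[OF \<phi>] by simp
  qed
  from AE_completion[OF this] eq show ?thesis by eventually_elim auto
qed

section \<open>The principal value\<close>

definition trunc_int :: "real \<Rightarrow> ('a::euclidean_space \<Rightarrow> real) \<Rightarrow> 'a \<Rightarrow> real \<Rightarrow> real" where
  "trunc_int s u x \<epsilon> = (\<integral>y. indicator {y. dist x y > \<epsilon>} y * (u x - u y)
                                    / dist x y powr (real DIM('a) + 2 * s) \<partial>lborel)"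

text \<open>The mean value theorem is applied to f (x + t h) + f (x - t h). Its derivative compares
  f' at two points that are 2 t h apart, and f' is B-Lipschitz, which gives 2 B |h|^2 for t <=
  1.\<close>

lemma second_difference_bound:
  fixes f :: "'a::euclidean_space \<Rightarrow> real" and f' :: "'a \<Rightarrow> 'a \<Rightarrow>\<^sub>L real" and f'' :: "'a \<Rightarrow> 'a \<Rightarrow>\<^sub>L ('a \<Rightarrow>\<^sub>L real)"
  assumes f: "\<And>y. y \<in> ball x \<rho> \<Longrightarrow> (f has_derivative blinfun_apply (f' y)) (at y)"
    and f': "\<And>y. y \<in> ball x \<rho> \<Longrightarrow> (f' has_derivative blinfun_apply (f'' y)) (at y)"
    and bound: "\<And>y. y \<in> ball x \<rho> \<Longrightarrow> norm (f'' y) \<le> B"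
    and h: "norm h < \<rho>"
  shows "\<bar>2 * f x - f (x + h) - f (x - h)\<bar> \<le> 2 * B * (norm h)\<^sup>2"
proof -
  have near: "x + t *\<^sub>R h \<in> ball x \<rho>" if "\<bar>t\<bar> \<le> 1" for t
    using that h mult_right_mono[OF that norm_ge_zero[of h]] by (simp add: dist_norm)
  have "0 < \<rho>" using h norm_ge_zero[of h] by linarith
  then have B: "0 \<le> B" using bound[of x] norm_ge_zero[of "f'' x"] by (simp del: norm_ge_zero)
  have lip: "norm (f' y - f' z) \<le> B * norm (y - z)" if "y \<in> ball x \<rho>" "z \<in> ball x \<rho>" for y z
    by (rule differentiable_bound[OF convex_ball _ _ that(1,2), where f' = "\<lambda>y. blinfun_apply (f'' y)"])
       (use f' bound in \<open>auto simp flip: norm_blinfun.rep_eq intro: has_derivative_at_withinI\<close>)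
  define g where "g t = f (x + t *\<^sub>R h) + f (x - t *\<^sub>R h)" for t
  have der: "(g has_real_derivative f' (x + t *\<^sub>R h) h - f' (x - t *\<^sub>R h) h) (at t)" if "\<bar>t\<bar> \<le> 1" for t
  proof -
    have 1: "((\<lambda>t. x + t *\<^sub>R h) has_derivative (\<lambda>d. d *\<^sub>R h)) (at t)"
      "((\<lambda>t. x - t *\<^sub>R h) has_derivative (\<lambda>d. - (d *\<^sub>R h))) (at t)"
      by (auto intro!: derivative_eq_intros)
    have "(f has_derivative blinfun_apply (f' (x + t *\<^sub>R h))) (at (x + t *\<^sub>R h))"
      "(f has_derivative blinfun_apply (f' (x - t *\<^sub>R h))) (at (x - t *\<^sub>R h))"
      using f[OF near[of t]] f[OF near[of "- t"]] that by auto
    from has_derivative_add[OF has_derivative_compose[OF 1(1) this(1)] has_derivative_compose[OF 1(2) this(2)]]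
    show ?thesis unfolding g_def has_field_derivative_def
      by (rule has_derivative_eq_rhs) (auto simp: blinfun.scaleR_right blinfun.minus_right algebra_simps)
  qed
  have "\<exists>z. 0 < z \<and> z < 1 \<and> g 1 - g 0 = (1 - 0) * (f' (x + z *\<^sub>R h) h - f' (x - z *\<^sub>R h) h)"
    by (rule MVT2) (use der in auto)
  then obtain z where z: "0 < z" "z < 1" "g 1 - g 0 = f' (x + z *\<^sub>R h) h - f' (x - z *\<^sub>R h) h" by auto
  have "\<bar>g 1 - g 0\<bar> = norm ((f' (x + z *\<^sub>R h) - f' (x - z *\<^sub>R h)) h)"
    by (simp add: z(3) blinfun.diff_left)
  also have "\<dots> \<le> norm (f' (x + z *\<^sub>R h) - f' (x - z *\<^sub>R h)) * norm h" by (rule norm_blinfun)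
  also have "\<dots> \<le> (B * norm ((x + z *\<^sub>R h) - (x - z *\<^sub>R h))) * norm h"
    using near[of z] near[of "- z"] z by (intro mult_right_mono lip) auto
  also have "(x + z *\<^sub>R h) - (x - z *\<^sub>R h) = (2 * z) *\<^sub>R h" by (simp add: algebra_simps flip: scaleR_add_left)
  also have "(B * norm ((2 * z) *\<^sub>R h)) * norm h = z * (2 * B * (norm h)\<^sup>2)"
    using z by (simp add: power2_eq_square)
  also have "\<dots> \<le> 1 * (2 * B * (norm h)\<^sup>2)" using z B by (intro mult_right_mono) auto
  finally show ?thesis by (simp add: g_def)
qed

text \<open>Averaging the substitutions y = x + h and y = x - h replaces first differences by second
  ones. The odd first-order part, which need not be absolutely integrable near 0 when s >= 1/2,
  cancels before \<epsilon> tends to 0.\<close>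

lemma trunc_int_symmetric:
  fixes u :: "'a::euclidean_space \<Rightarrow> real" and s B \<epsilon> :: real
  assumes s: "0 < s" and cont: "continuous_on UNIV u" and bound: "\<And>y. \<bar>u y\<bar> \<le> B" and \<epsilon>: "0 < \<epsilon>"
  shows "2 * trunc_int s u x \<epsilon> = (\<integral>h. indicator {h. norm h > \<epsilon>} h *
    ((2 * u x - u (x + h) - u (x - h)) * norm h powr - (DIM('a) + 2 * s)) \<partial>lborel)"
proof -
  have [measurable]: "u \<in> borel_measurable borel" by (rule borel_measurable_continuous_onI[OF cont])
  define G where "G c h = indicator {h. norm h > \<epsilon>} h * (u x - u (x + c *\<^sub>R h)) * norm h powr - (DIM('a) + 2 * s)" for c and h :: 'a
  have [measurable]: "{h::'a. norm h > \<epsilon>} \<in> sets borel" by measurable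
  have [measurable]: "G c \<in> borel_measurable borel" for c unfolding G_def by measurable
  have int: "integrable lborel (G c)" for c
  proof (rule Bochner_Integration.integrable_bound)
    show "integrable lborel (\<lambda>h::'a. 2 * B * (indicator (- ball 0 \<epsilon>) h * dist 0 h powr - (DIM('a) + 2 * s)))"
      using s \<epsilon> by (intro integrable_mult_right integrable_kernel_outside_ball) auto
    have "\<bar>G c h\<bar> \<le> 2 * B * (indicator (- ball 0 \<epsilon>) h * dist 0 h powr - (DIM('a) + 2 * s))" for h
    proof (cases "norm h > \<epsilon>")
      case True
      have "\<bar>u x - u (x + c *\<^sub>R h)\<bar> \<le> 2 * B" using bound[of x] bound[of "x + c *\<^sub>R h"] by linarith
      then show ?thesis using True by (simp add: G_def abs_mult mult_right_mono)
    next
      case False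
      have "0 \<le> B" using bound[of x] by linarith
      then show ?thesis using False by (simp add: G_def)
    qed
    then show "AE h in lborel. norm (G c h) \<le> norm (2 * B * (indicator (- ball 0 \<epsilon>) h * dist 0 h powr - (DIM('a) + 2 * s)))"
      by (auto intro!: AE_I2 order_trans[OF _ abs_ge_self])
  qed measurable
  have G: "trunc_int s u x \<epsilon> = (\<integral>h. G c h \<partial>lborel)" if "\<bar>c\<bar> = 1" for c
  proof -
    have "trunc_int s u x \<epsilon> = (\<integral>h. indicator {y. dist x y > \<epsilon>} (x + c *\<^sub>R h) * (u x - u (x + c *\<^sub>R h))
                                    / dist x (x + c *\<^sub>R h) powr (real DIM('a) + 2 * s) \<partial>lborel)"
      unfolding trunc_int_def
      by (rule integral_lborel_affine[OF that, symmetric]) measurable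
    also have "\<dots> = (\<integral>h. G c h \<partial>lborel)"
      unfolding G_def powr_minus_divide
      by (rule Bochner_Integration.integral_cong[OF refl])
         (use that in \<open>auto simp: dist_norm indicator_def\<close>)
    finally show ?thesis .
  qed
  have "2 * trunc_int s u x \<epsilon> = (\<integral>h. G 1 h \<partial>lborel) + (\<integral>h. G (-1) h \<partial>lborel)"
    using G[of 1] G[of "-1"] by simp
  also have "\<dots> = (\<integral>h. G 1 h + G (-1) h \<partial>lborel)" using int by simp
  also have "\<dots> = (\<integral>h. indicator {h. norm h > \<epsilon>} h *
    ((2 * u x - u (x + h) - u (x - h)) * norm h powr - (DIM('a) + 2 * s)) \<partial>lborel)"
    by (rule Bochner_Integration.integral_cong[OF refl]) (simp add: G_def algebra_simps)
  finally show ?thesis .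
qed

text \<open>Second differences are O(|h|^2) near 0, since u agrees with a C^2 function around x, and
  bounded elsewhere. The symmetrised integrand is therefore absolutely integrable and dominates its
  truncations.\<close>

lemma trunc_int_convergent:
  fixes u f :: "'a::euclidean_space \<Rightarrow> real" and s s' B :: real
  assumes s: "0 < s" "s < 1" and cont: "continuous_on UNIV u" and bound: "\<And>y. \<bar>u y\<bar> \<le> B"
    and U: "open U" "x \<in> U" and uf: "\<And>y. y \<in> U \<Longrightarrow> u y = f y" and f: "C2s_on U s' f"
  shows "\<exists>L. (trunc_int s u x \<longlongrightarrow> L) (at_right 0)"
proof -
  have [measurable]: "u \<in> borel_measurable borel" by (rule borel_measurable_continuous_onI[OF cont])
  obtain f' :: "'a \<Rightarrow> 'a \<Rightarrow>\<^sub>L real" and f'' :: "'a \<Rightarrow> 'a \<Rightarrow>\<^sub>L ('a \<Rightarrow>\<^sub>L real)" and M where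
    f': "\<And>x. x \<in> U \<Longrightarrow> (f has_derivative blinfun_apply (f' x)) (at x)"
        "\<And>x. x \<in> U \<Longrightarrow> (f' has_derivative blinfun_apply (f'' x)) (at x)"
        "\<And>x. x \<in> U \<Longrightarrow> norm (f'' x) \<le> M"
    using f unfolding C2s_on_def by blast
  obtain \<rho> where \<rho>: "0 < \<rho>" "ball x \<rho> \<subseteq> U" using U open_contains_ball by blast
  define D where "D h = 2 * u x - u (x + h) - u (x - h)" for h
  have [measurable]: "D \<in> borel_measurable borel" unfolding D_def by measurable
  have B: "0 \<le> B" using bound[of x] by linarith
  have M: "0 \<le> M" using order_trans[OF norm_ge_zero f'(3)[OF U(2)]] .
  \<comment> \<open>The summands serve |h| < \<rho> with bound 2 M |h|^2, the global bound 4 B, and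
    |h| >= \<rho>, where 4 B <= (4 B / \<rho>^2) * |h|^2.\<close>
  define C where "C = 2 * M + 4 * B + 4 * B / \<rho>\<^sup>2"
  have C: "2 * M \<le> C" "4 * B \<le> C" "4 * B / \<rho>\<^sup>2 \<le> C" using B M by (auto simp: C_def)
  have D_le: "\<bar>D h\<bar> \<le> 4 * B" for h
    using bound[of x] bound[of "x + h"] bound[of "x - h"] by (simp add: D_def abs_le_iff)
  have int: "integrable lborel (\<lambda>h. D h * norm h powr - (DIM('a) + 2 * s))"
  proof (rule integrable_mult_kernel[where p = 2 and C = C])
    fix h
    show "\<bar>D h\<bar> \<le> C" using D_le[of h] C by linarith
    show "\<bar>D h\<bar> \<le> C * norm h powr 2"
    proof (cases "norm h < \<rho>")
      case True
      then have "x + h \<in> U" "x - h \<in> U" using \<rho> by (auto simp: subset_iff dist_norm)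
      then have "D h = 2 * f x - f (x + h) - f (x - h)" using uf U by (simp add: D_def)
      also have "\<bar>\<dots>\<bar> \<le> 2 * M * (norm h)\<^sup>2"
        by (rule second_difference_bound[where \<rho> = \<rho> and f' = f' and f'' = f'']) (use True \<rho> f' in auto)
      also have "\<dots> \<le> C * (norm h)\<^sup>2" using C by (intro mult_right_mono) auto
      finally show ?thesis by (simp add: powr_numeral)
    next
      case False
      have "\<bar>D h\<bar> \<le> 4 * B / \<rho>\<^sup>2 * \<rho>\<^sup>2" using D_le[of h] \<rho> by simp
      also have "\<dots> \<le> C * (norm h)\<^sup>2"
        using False \<rho> C B M by (intro mult_mono power_mono) (auto simp: C_def)
      finally show ?thesis by (simp add: powr_numeral)
    qed
  qed (use s in auto)
  define L where "L = (\<integral>h. D h * norm h powr - (DIM('a) + 2 * s) \<partial>lborel)"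
  have "(trunc_int s u x \<longlongrightarrow> L / 2) (at_right 0)"
    unfolding tendsto_at_iff_sequentially
  proof (intro allI impI)
    fix X :: "nat \<Rightarrow> real" assume X: "\<forall>i. X i \<in> {0<..} - {0}" "X \<longlonglongrightarrow> 0"
    have "(\<lambda>k. \<integral>h. indicator {h. norm h > X k} h * (D h * norm h powr - (DIM('a) + 2 * s)) \<partial>lborel) \<longlonglongrightarrow> L"
      unfolding L_def
    proof (rule integral_dominated_convergence[where w = "\<lambda>h. norm (D h * norm h powr - (DIM('a) + 2 * s))"])
      have "(\<lambda>k. indicator {h. norm h > X k} h * (D h * norm h powr - (DIM('a) + 2 * s)))
        \<longlonglongrightarrow> D h * norm h powr - (DIM('a) + 2 * s)" for h
      proof (cases "h = 0")
        case False
        then have "\<forall>\<^sub>F k in sequentially. X k < norm h" using X(2) by (intro order_tendstoD) auto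
        then have "\<forall>\<^sub>F k in sequentially. indicator {h. norm h > X k} h * (D h * norm h powr - (DIM('a) + 2 * s))
           = D h * norm h powr - (DIM('a) + 2 * s)" by eventually_elim simp
        then show ?thesis by (rule tendsto_eventually)
      qed simp
      then show "AE h in lborel. (\<lambda>k. indicator {h. norm h > X k} h * (D h * norm h powr - (DIM('a) + 2 * s)))
        \<longlonglongrightarrow> D h * norm h powr - (DIM('a) + 2 * s)" by simp
    qed (use int in \<open>auto simp: indicator_def\<close>)
    then have "(\<lambda>k. (\<integral>h. indicator {h. norm h > X k} h * (D h * norm h powr - (DIM('a) + 2 * s)) \<partial>lborel) / 2) \<longlonglongrightarrow> L / 2"
      by (intro tendsto_intros) auto
    moreover have "trunc_int s u x (X k) = (\<integral>h. indicator {h. norm h > X k} h * (D h * norm h powr - (DIM('a) + 2 * s)) \<partial>lborel) / 2" for k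
      using trunc_int_symmetric[OF s(1) cont bound, of "X k" x] X(1) by (simp add: D_def)
    ultimately show "(trunc_int s u x \<circ> X) \<longlonglongrightarrow> L / 2" by (simp only: comp_def)
  qed
  then show ?thesis by blast
qed

text \<open>\<open>Gamma\<close> takes the default value 0 exactly at its poles, and -s lies
  strictly between the poles -1 and 0, so the denominator is genuinely positive. This lets the
  constant be cancelled.\<close>

lemma frac_const_pos:
  assumes "0 < s" "s < 1"
  shows "0 < frac_const n s"
proof -
  have "- s \<notin> \<int>\<^sub>\<le>\<^sub>0"
  proof
    assume "- s \<in> \<int>\<^sub>\<le>\<^sub>0"
    then obtain k :: int where "- s = of_int k" unfolding nonpos_Ints_def by blast
    then have "- 1 < real_of_int k" "real_of_int k < 0" using assms by auto
    then have "- 1 < k" "k < 0" by linarith+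
    then show False by linarith
  qed
  then have "Gamma (- s) \<noteq> 0" by (simp add: Gamma_eq_zero_iff)
  moreover have "0 < Gamma (real n / 2 + s)" using assms by (intro Gamma_real_pos) (simp add: add_nonneg_pos)
  ultimately show ?thesis by (simp add: frac_const_def)
qed

text \<open>The principal value converges, so \<^const>\<open>Lim\<close> is not a junk value here.\<close>
lemma frac_lap_eq_imp_potential_eq_0:
  fixes u1 u2 f :: "'a::euclidean_space \<Rightarrow> real" and s s' B :: real
  assumes s: "0 < s" "s < 1" and cont: "continuous_on UNIV u1" "continuous_on UNIV u2"
    and bound: "\<And>y. \<bar>u1 y\<bar> \<le> B" "\<And>y. \<bar>u2 y\<bar> \<le> B"
    and U: "open U" "x \<in> U" and uf: "\<And>y. y \<in> U \<Longrightarrow> u1 y = f y" "\<And>y. y \<in> U \<Longrightarrow> u2 y = f y"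
    and f: "C2s_on U s' f" and eq: "frac_lap s u1 x = frac_lap s u2 x"
  shows "(\<integral>y. (u1 y - u2 y) * norm (x - y) powr - (DIM('a) + 2 * s) \<partial>lborel) = 0" (is "?V = 0")
proof -
  have [measurable]: "u1 \<in> borel_measurable borel" "u2 \<in> borel_measurable borel"
    using cont by (auto intro: borel_measurable_continuous_onI)
  obtain L1 L2 where L: "(trunc_int s u1 x \<longlongrightarrow> L1) (at_right 0)" "(trunc_int s u2 x \<longlongrightarrow> L2) (at_right 0)"
    using trunc_int_convergent[OF s cont(1) bound(1) U uf(1) f] trunc_int_convergent[OF s cont(2) bound(2) U uf(2) f] by blast
  have "frac_lap s u1 x = frac_const DIM('a) s * L1" "frac_lap s u2 x = frac_const DIM('a) s * L2"
    using tendsto_Lim[OF _ L(1)] tendsto_Lim[OF _ L(2)] by (auto simp: frac_lap_def trunc_int_def[abs_def])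
  then have "L1 = L2" using eq frac_const_pos[OF s, of "DIM('a)"] by simp
  obtain \<rho> where \<rho>: "0 < \<rho>" "ball x \<rho> \<subseteq> U" using U open_contains_ball by blast
  \<comment> \<open>Within distance \<rho> of x both functions equal f, so the cut-off removes
    nothing from their difference: it is constant for small \<epsilon>, although neither integral
    alone need converge absolutely without the cut-off.\<close>
  have diff: "trunc_int s u2 x \<epsilon> - trunc_int s u1 x \<epsilon> = ?V" if \<epsilon>: "0 < \<epsilon>" "\<epsilon> < \<rho>" for \<epsilon>
  proof -
    let ?k = "\<lambda>u y. indicator {y. dist x y > \<epsilon>} y * (u x - u y) / dist x y powr (real DIM('a) + 2 * s)"
    have int: "integrable lborel (?k u)"
      if [measurable]: "u \<in> borel_measurable borel" and bound: "\<And>y. \<bar>u y\<bar> \<le> B" for u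
    proof (rule Bochner_Integration.integrable_bound)
      show "integrable lborel (\<lambda>y. 2 * B * (indicator (- ball x \<epsilon>) y * dist x y powr - (DIM('a) + 2 * s)))"
        using s \<epsilon> by (intro integrable_mult_right integrable_kernel_outside_ball) auto
      have "\<bar>?k u y\<bar> \<le> 2 * B * (indicator (- ball x \<epsilon>) y * dist x y powr - (DIM('a) + 2 * s))" for y
      proof (cases "dist x y > \<epsilon>")
        case True
        have "\<bar>u x - u y\<bar> \<le> 2 * B" using bound[of x] bound[of y] by linarith
        then have "\<bar>u x - u y\<bar> * dist x y powr - (DIM('a) + 2 * s) \<le> 2 * B * dist x y powr - (DIM('a) + 2 * s)"
          by (rule mult_right_mono) simp
        then show ?thesis using True unfolding powr_minus_divide by simp
      next
        case False
        have "0 \<le> B" using bound[of x] by linarith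
        then show ?thesis using False by simp
      qed
      then show "AE y in lborel. norm (?k u y) \<le> norm (2 * B * (indicator (- ball x \<epsilon>) y * dist x y powr - (DIM('a) + 2 * s)))"
        by (auto intro!: AE_I2 order_trans[OF _ abs_ge_self])
    qed measurable
    have "trunc_int s u2 x \<epsilon> - trunc_int s u1 x \<epsilon> = (\<integral>y. ?k u2 y - ?k u1 y \<partial>lborel)"
      unfolding trunc_int_def using int bound by simp
    also have "\<dots> = ?V"
    proof (rule Bochner_Integration.integral_cong[OF refl])
      fix y
      have x: "u1 x = u2 x" using uf U by simp
      show "?k u2 y - ?k u1 y = (u1 y - u2 y) * norm (x - y) powr - (DIM('a) + 2 * s)"
      proof (cases "dist x y > \<epsilon>")
        case True
        then show ?thesis unfolding powr_minus_divide by (simp add: x dist_norm diff_divide_distrib)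
      next
        case False
        then have "y \<in> U" using \<epsilon> \<rho> by auto
        then show ?thesis using False uf by simp
      qed
    qed
    finally show ?thesis .
  qed
  have "((\<lambda>\<epsilon>. trunc_int s u2 x \<epsilon> - trunc_int s u1 x \<epsilon>) \<longlongrightarrow> L2 - L1) (at_right 0)"
    by (intro tendsto_diff L)
  moreover have "((\<lambda>\<epsilon>. trunc_int s u2 x \<epsilon> - trunc_int s u1 x \<epsilon>) \<longlongrightarrow> ?V) (at_right 0)"
  proof (rule tendsto_eventually)
    have "\<forall>\<^sub>F \<epsilon> in at_right 0. \<epsilon> \<in> {0<..<\<rho>}" using \<rho>(1) by (rule eventually_at_right_real)
    then show "\<forall>\<^sub>F \<epsilon> in at_right 0. trunc_int s u2 x \<epsilon> - trunc_int s u1 x \<epsilon> = ?V"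
      by eventually_elim (use diff in auto)
  qed
  ultimately have "L2 - L1 = ?V" by (rule tendsto_unique[rotated]) simp
  then show ?thesis using \<open>L1 = L2\<close> by simp
qed

section \<open>The bilinear form\<close>

lemma test_fun_mono: "test_fun A \<phi> \<Longrightarrow> A \<subseteq> B \<Longrightarrow> test_fun B \<phi>"
  unfolding test_fun_def by blast

lemma test_fun_zero: "test_fun \<Omega> \<phi> \<Longrightarrow> x \<notin> \<Omega> \<Longrightarrow> \<phi> x = 0"
  unfolding test_fun_def using closure_subset[of "{x. \<phi> x \<noteq> 0}"] by blast

lemma test_fun_bounded:
  assumes "test_fun \<Omega> \<phi>"
  obtains M where "0 \<le> M" "\<And>x. \<bar>\<phi> x\<bar> \<le> M"
proof -
  let ?K = "closure {x. \<phi> x \<noteq> 0}"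
  have "compact ?K" using assms unfolding test_fun_def by blast
  then have "bounded (\<phi> ` ?K)"
    using continuous_on_subset[OF test_fun_continuous[OF assms]] compact_continuous_image
      compact_imp_bounded by (metis subset_UNIV)
  then obtain M where M: "\<And>x. x \<in> ?K \<Longrightarrow> \<bar>\<phi> x\<bar> \<le> M" unfolding bounded_iff by auto
  have "\<bar>\<phi> x\<bar> \<le> max 0 M" for x
  proof (cases "\<phi> x = 0")
    case False
    then have "x \<in> ?K" using closure_subset[of "{x. \<phi> x \<noteq> 0}"] by blast
    then show ?thesis using M[of x] by linarith
  qed simp
  then show thesis using that[of "max 0 M"] by simp
qed

text \<open>The derivative is continuous, hence bounded, on the compact support, and it is zero
  elsewhere because the function vanishes near each such point.\<close>

lemma test_fun_Lipschitz:
  assumes "test_fun \<Omega> \<phi>"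
  obtains L where "0 \<le> L" "\<And>x y. \<bar>\<phi> x - \<phi> y\<bar> \<le> L * norm (x - y)"
proof -
  let ?K = "closure {x. \<phi> x \<noteq> 0}"
  obtain \<phi>' :: "'a \<Rightarrow> 'a \<Rightarrow>\<^sub>L real" where \<phi>': "\<And>x. (\<phi> has_derivative blinfun_apply (\<phi>' x)) (at x)"
     "continuous_on UNIV \<phi>'" and K: "compact ?K"
    using assms unfolding test_fun_def by blast
  have "bounded (\<phi>' ` ?K)"
    using K continuous_on_subset[OF \<phi>'(2)] compact_continuous_image compact_imp_bounded
    by (metis subset_UNIV)
  then obtain L where L: "\<And>x. x \<in> ?K \<Longrightarrow> norm (\<phi>' x) \<le> L" unfolding bounded_iff by auto
  have bound: "norm (\<phi>' x) \<le> max 0 L" for x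
  proof (cases "x \<in> ?K")
    case True
    then show ?thesis using L[of x] by linarith
  next
    case False
    have zero: "\<phi> y = 0" if "y \<in> - ?K" for y
      using that closure_subset[of "{x. \<phi> x \<noteq> 0}"] by blast
    have "open (- ?K)" "x \<in> - ?K" using False by (simp_all only: open_Compl closed_closure Compl_iff not_False_eq_True)
    then have "((\<lambda>_. 0) has_derivative blinfun_apply (\<phi>' x)) (at x)"
      by (rule has_derivative_transform_within_open[OF \<phi>'(1)]) (rule zero)
    then have "blinfun_apply (\<phi>' x) = (\<lambda>_. 0)"
      using has_derivative_unique[OF _ has_derivative_const] by blast
    then have "\<phi>' x = 0" by (intro blinfun_eqI) simp
    then show ?thesis by simp
  qed
  have "norm (\<phi> x - \<phi> y) \<le> max 0 L * norm (x - y)" for x y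
    by (rule differentiable_bound[of UNIV \<phi> "\<lambda>x. blinfun_apply (\<phi>' x)"])
       (use \<phi>' bound in \<open>auto simp flip: norm_blinfun.rep_eq\<close>)
  then show thesis using that[of "max 0 L"] by simp
qed

lemma integrable_pair_product:
  fixes f g :: "'a::euclidean_space \<Rightarrow> real"
  assumes f: "integrable lborel f" and g: "integrable lborel g"
  shows "integrable (lborel \<Otimes>\<^sub>M lborel) (\<lambda>p. f (fst p) * g (snd p))"
proof (rule lborel_pair.Fubini_integrable)
  have [measurable]: "f \<in> borel_measurable borel" "g \<in> borel_measurable borel"
    using f g by auto
  show "(\<lambda>p. f (fst p) * g (snd p)) \<in> borel_measurable (lborel \<Otimes>\<^sub>M lborel)" by measurable
  show "integrable lborel (\<lambda>x. \<integral>y. norm (f (fst (x, y)) * g (snd (x, y))) \<partial>lborel)"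
    using f g by (simp add: abs_mult)
qed (use g in auto)

lemma integrable_pair_convolution:
  fixes f k :: "'a::euclidean_space \<Rightarrow> real"
  assumes f: "integrable lborel f" and k: "integrable lborel k"
  shows "integrable (lborel \<Otimes>\<^sub>M lborel) (\<lambda>p. f (fst p) * k (fst p - snd p))"
proof (rule lborel_pair.Fubini_integrable)
  have [measurable]: "f \<in> borel_measurable borel" "k \<in> borel_measurable borel"
    using f k by auto
  show "(\<lambda>p. f (fst p) * k (fst p - snd p)) \<in> borel_measurable (lborel \<Otimes>\<^sub>M lborel)" by measurable
  have "(\<integral>y. \<bar>k (x - y)\<bar> \<partial>lborel) = (\<integral>y. \<bar>k y\<bar> \<partial>lborel)" for x
    using integral_lborel_affine[of "-1" "\<lambda>y. \<bar>k y\<bar>" x] by simp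
  then show "integrable lborel (\<lambda>x. \<integral>y. norm (f (fst (x, y)) * k (fst (x, y) - snd (x, y))) \<partial>lborel)"
    using f by (simp add: abs_mult)
  have "integrable lborel (\<lambda>y. k (x - y))" for x
    using integrable_lborel_affine[of "-1" k x] k by simp
  then show "AE x in lborel. integrable lborel (\<lambda>y. f (fst (x, y)) * k (fst (x, y) - snd (x, y)))"
    by simp
qed

definition form_integrand :: "real \<Rightarrow> ('a::euclidean_space \<Rightarrow> real) \<Rightarrow> ('a \<Rightarrow> real) \<Rightarrow> 'a \<times> 'a \<Rightarrow> real" where
  "form_integrand s u \<phi> p = (u (fst p) - u (snd p)) * (\<phi> (fst p) - \<phi> (snd p))
            / dist (fst p) (snd p) powr (real DIM('a) + 2 * s)"

lemma frac_form_eq: "frac_form s u \<phi> =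
    frac_const DIM('a::euclidean_space) s / 2 * (\<integral>p. form_integrand s u \<phi> p \<partial>(lborel \<Otimes>\<^sub>M (lborel :: 'a measure)))"
  by (simp add: frac_form_def form_integrand_def)

text \<open>One increment is s-Hoelder, the other Lipschitz, and both are bounded, so the numerator
  is at most C * min 1 (|x - y|^(1 + s)); 1 + s > 2 * s makes \<open>k\<close> integrable. The
  integrand vanishes unless x or y lies in the compact set S, which supplies integrability in the
  remaining variable.\<close>

lemma form_integrand_integrable:
  fixes u \<phi> :: "'a::euclidean_space \<Rightarrow> real" and s :: real
  assumes s: "0 < s" "s < 1" and u: "holder_on UNIV s u" and \<phi>: "test_fun \<Omega> \<phi>"
  shows "integrable (lborel \<Otimes>\<^sub>M lborel) (form_integrand s u \<phi>)"
proof -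
  obtain B Cu where cont: "continuous_on UNIV u" and B: "\<And>x. \<bar>u x\<bar> \<le> B"
    and Cu: "\<And>x y. \<bar>u x - u y\<bar> \<le> Cu * dist x y powr s"
    using u unfolding holder_on_def bounded_iff by auto
  have B0: "0 \<le> B" using B[of 0] by linarith
  obtain M where M: "0 \<le> M" "\<And>x. \<bar>\<phi> x\<bar> \<le> M" using test_fun_bounded[OF \<phi>] by blast
  obtain L where L: "0 \<le> L" "\<And>x y. \<bar>\<phi> x - \<phi> y\<bar> \<le> L * norm (x - y)" using test_fun_Lipschitz[OF \<phi>] by blast
  have [measurable]: "u \<in> borel_measurable borel" "\<phi> \<in> borel_measurable borel"
    using cont test_fun_continuous[OF \<phi>] by (auto intro: borel_measurable_continuous_onI)
  define S where "S = closure {x. \<phi> x \<noteq> 0}"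
  have S: "compact S" "\<And>x. x \<notin> S \<Longrightarrow> \<phi> x = 0"
    using \<phi> closure_subset[of "{x. \<phi> x \<noteq> 0}"] unfolding test_fun_def S_def by auto
  define C where "C = max (\<bar>Cu\<bar> * L) (4 * B * M)"
  have C0: "0 \<le> C" using L by (simp add: C_def le_max_iff_disj)
  define g where "g h = min C (C * norm h powr (1 + s))" for h :: 'a
  define k where "k h = g h * norm h powr - (DIM('a) + 2 * s)" for h
  have [measurable]: "g \<in> borel_measurable borel" unfolding g_def by measurable
  have k: "integrable lborel k" unfolding k_def
    by (rule integrable_mult_kernel[where p = "1 + s" and C = C]) (use s C0 in \<open>auto simp: g_def\<close>)
  have ind: "integrable lborel (indicator S :: 'a \<Rightarrow> real)"
    using S(1) by (intro integrable_real_indicator)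
      (auto simp: borel_compact less_top[symmetric] dest: emeasure_compact_finite)
  have g: "\<bar>(u x - u y) * (\<phi> x - \<phi> y)\<bar> \<le> g (x - y)" for x y
  proof -
    have "\<bar>u x - u y\<bar> \<le> 2 * B" "\<bar>\<phi> x - \<phi> y\<bar> \<le> 2 * M"
      using B[of x] B[of y] M(2)[of x] M(2)[of y] by linarith+
    then have "\<bar>(u x - u y) * (\<phi> x - \<phi> y)\<bar> \<le> (2 * B) * (2 * M)"
      unfolding abs_mult using B0 by (intro mult_mono) auto
    then have 1: "\<bar>(u x - u y) * (\<phi> x - \<phi> y)\<bar> \<le> C" by (simp add: C_def)
    have "\<bar>u x - u y\<bar> \<le> \<bar>Cu\<bar> * norm (x - y) powr s"
      using order_trans[OF Cu[of x y] mult_right_mono[OF abs_ge_self]] by (simp add: dist_norm)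
    then have "\<bar>(u x - u y) * (\<phi> x - \<phi> y)\<bar> \<le> (\<bar>Cu\<bar> * norm (x - y) powr s) * (L * norm (x - y))"
      unfolding abs_mult using L by (intro mult_mono) auto
    also have "\<dots> = (\<bar>Cu\<bar> * L) * (norm (x - y) * norm (x - y) powr s)" by (simp add: mult_ac)
    also have "\<dots> = (\<bar>Cu\<bar> * L) * norm (x - y) powr (1 + s)"
      by (simp only: norm_powr_mult_self add.commute[of s 1])
    also have "\<dots> \<le> C * norm (x - y) powr (1 + s)"
      by (intro mult_right_mono) (auto simp: C_def)
    finally show ?thesis using 1 by (simp add: g_def)
  qed
  have sym: "k (y - x) = k (x - y)" for x y by (simp add: k_def g_def norm_minus_commute)
  show ?thesis
  proof (rule Bochner_Integration.integrable_bound)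
    have i1: "integrable (lborel \<Otimes>\<^sub>M lborel) (\<lambda>p. indicator S (fst p) * k (fst p - snd p))"
      by (rule integrable_pair_convolution[OF ind k])
    from lborel_pair.integrable_product_swap[OF this]
    have i2: "integrable (lborel \<Otimes>\<^sub>M lborel) (\<lambda>p. indicator S (snd p) * k (fst p - snd p))"
      by (simp add: case_prod_unfold sym)
    show "integrable (lborel \<Otimes>\<^sub>M lborel) (\<lambda>p. indicator S (fst p) * k (fst p - snd p)
        + indicator S (snd p) * k (fst p - snd p))"
      by (rule Bochner_Integration.integrable_add[OF i1 i2])
    show "form_integrand s u \<phi> \<in> borel_measurable (lborel \<Otimes>\<^sub>M lborel)"
      unfolding form_integrand_def[abs_def] by measurable
    have le: "\<bar>form_integrand s u \<phi> (x, y)\<bar> \<le> indicator S x * k (x - y) + indicator S y * k (x - y)" for x y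
    proof -
      have k0: "0 \<le> k (x - y)" using C0 by (simp add: k_def g_def)
      show ?thesis
      proof (cases "x \<in> S \<or> y \<in> S")
        case True
        have "form_integrand s u \<phi> (x, y) = ((u x - u y) * (\<phi> x - \<phi> y)) * norm (x - y) powr - (DIM('a) + 2 * s)"
          unfolding form_integrand_def powr_minus_divide by (simp add: dist_norm)
        then have "\<bar>form_integrand s u \<phi> (x, y)\<bar> = \<bar>(u x - u y) * (\<phi> x - \<phi> y)\<bar> * norm (x - y) powr - (DIM('a) + 2 * s)"
          by (simp add: abs_mult)
        also have "\<dots> \<le> k (x - y)" unfolding k_def by (intro mult_right_mono g) auto
        finally show ?thesis using True k0 by (auto simp: indicator_def)
      next
        case False
        then show ?thesis using S by (simp add: form_integrand_def)
      qed
    qed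
    show "AE p in lborel \<Otimes>\<^sub>M lborel. norm (form_integrand s u \<phi> p)
       \<le> norm (indicator S (fst p) * k (fst p - snd p) + indicator S (snd p) * k (fst p - snd p))"
    proof (rule AE_I2)
      fix p
      show "norm (form_integrand s u \<phi> p)
       \<le> norm (indicator S (fst p) * k (fst p - snd p) + indicator S (snd p) * k (fst p - snd p))"
        using order_trans[OF le[of "fst p" "snd p"] abs_ge_self] by (simp only: real_norm_def prod.collapse)
    qed
  qed
qed

text \<open>The integral may be split only because both parts are integrable: a non-integrable
  function has Bochner integral 0 by convention.\<close>

lemma frac_form_diff:
  fixes u v :: "'a::euclidean_space \<Rightarrow> real"
  assumes "0 < s" "s < 1" "holder_on UNIV s u" "holder_on UNIV s v" "test_fun \<Omega> \<phi>"
  shows "frac_form s (\<lambda>x. u x - v x) \<phi> = frac_form s u \<phi> - frac_form s v \<phi>"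
proof -
  have eq: "form_integrand s (\<lambda>x. u x - v x) \<phi> = (\<lambda>p. form_integrand s u \<phi> p - form_integrand s v \<phi> p)"
  proof (rule ext)
    fix p :: "'a \<times> 'a"
    have "(u (fst p) - v (fst p) - (u (snd p) - v (snd p))) * (\<phi> (fst p) - \<phi> (snd p))
      = (u (fst p) - u (snd p)) * (\<phi> (fst p) - \<phi> (snd p)) - (v (fst p) - v (snd p)) * (\<phi> (fst p) - \<phi> (snd p))"
      by (simp add: algebra_simps)
    then show "form_integrand s (\<lambda>x. u x - v x) \<phi> p = form_integrand s u \<phi> p - form_integrand s v \<phi> p"
      by (simp only: form_integrand_def diff_divide_distrib)
  qed
  show ?thesis
    unfolding frac_form_eq eq
      Bochner_Integration.integral_diff[OF form_integrand_integrable[OF assms(1,2,3,5)] form_integrand_integrable[OF assms(1,2,4,5)]]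
    by (rule right_diff_distrib)
qed

lemma holder_on_diff:
  assumes "holder_on S s u" "holder_on S s v"
  shows "holder_on S s (\<lambda>x. u x - v x)"
proof -
  obtain C D where C: "\<And>x y. x \<in> S \<Longrightarrow> y \<in> S \<Longrightarrow> \<bar>u x - u y\<bar> \<le> C * dist x y powr s"
    and D: "\<And>x y. x \<in> S \<Longrightarrow> y \<in> S \<Longrightarrow> \<bar>v x - v y\<bar> \<le> D * dist x y powr s"
    using assms unfolding holder_on_def by metis
  have "\<bar>(u x - v x) - (u y - v y)\<bar> \<le> (C + D) * dist x y powr s" if "x \<in> S" "y \<in> S" for x y
    using C[OF that] D[OF that] by (simp add: algebra_simps)
  then have "\<exists>C. \<forall>x\<in>S. \<forall>y\<in>S. \<bar>(u x - v x) - (u y - v y)\<bar> \<le> C * dist x y powr s" by blast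
  moreover have "bounded ((\<lambda>x. u x - v x) ` S)"
    using assms unfolding holder_on_def by (intro bounded_minus_comp) auto
  ultimately show ?thesis using assms unfolding holder_on_def by (auto intro: continuous_on_diff)
qed

section \<open>The weak form as a pairing with the Riesz potential\<close>

context
  fixes x0 :: "'a::euclidean_space" and r s B :: real and v :: "'a \<Rightarrow> real"
  assumes s: "0 < s" "s < 1" and r: "0 < r" and cont: "continuous_on UNIV v"
    and bound: "\<And>y. \<bar>v y\<bar> \<le> B" and zero: "\<And>y. y \<in> ball x0 r \<Longrightarrow> v y = 0"
begin

definition potential :: "'a \<Rightarrow> real" where
  "potential x = (\<integral>y. v y * norm (x - y) powr - (DIM('a) + 2 * s) \<partial>lborel)"

text \<open>The bound of \<open>kernel_dominated\<close> for q = v, b = n + 2 * s and e = 0, uniform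
  over the half ball.\<close>

definition "majorant y =
  B * 2 powr (DIM('a) + 2 * s) * (indicator (- ball x0 r) y * dist x0 y powr - (DIM('a) + 2 * s))"

lemma v_measurable[measurable]: "v \<in> borel_measurable borel"
  using cont by (rule borel_measurable_continuous_onI)

lemma integrable_majorant: "integrable lborel majorant"
  unfolding majorant_def using s r
  by (intro integrable_mult_right integrable_kernel_outside_ball) auto

lemma potential_dominated:
  assumes "x \<in> ball x0 (r/2)"
  shows "\<bar>v y\<bar> * norm (x - y) powr - (DIM('a) + 2 * s) \<le> majorant y"
proof -
  \<comment> \<open>The exponent reduces to 0, and \<open>0 powr 0 = 0\<close>; at y = x0 the bound
    therefore relies on v x0 = 0.\<close>
  have "\<bar>v y\<bar> \<le> B * norm (y - x0) powr ((DIM('a) + 2 * s) - DIM('a) - 2 * s)" for y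
    using bound[of y] zero[of x0] r by (cases "y = x0") auto
  from kernel_dominated[OF r _ v_measurable zero _ this assms, of 0] s
  show ?thesis using r by (simp add: majorant_def)
qed

lemma potential_measurable[measurable]: "potential \<in> borel_measurable borel"
  unfolding potential_def by measurable

lemma potential_bound:
  assumes "x \<in> ball x0 (r/2)"
  shows "\<bar>potential x\<bar> \<le> (\<integral>y. majorant y \<partial>lborel)"
proof -
  have "\<bar>potential x\<bar> \<le> (\<integral>y. \<bar>v y * norm (x - y) powr - (DIM('a) + 2 * s)\<bar> \<partial>lborel)"
    unfolding potential_def by (rule integral_abs_bound)
  also have "\<dots> \<le> (\<integral>y. majorant y \<partial>lborel)"
  proof (rule Bochner_Integration.integral_mono'[OF integrable_majorant])
    fix y
    show "\<bar>v y * norm (x - y) powr - (DIM('a) + 2 * s)\<bar> \<le> majorant y"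
      using potential_dominated[OF assms, of y] by (simp add: abs_mult)
    show "0 \<le> majorant y"
      by (rule order_trans[OF _ potential_dominated[OF assms, of y]]) simp
  qed
  finally show ?thesis .
qed

lemma potential_continuous: "continuous_on (ball x0 (r/2)) potential"
  unfolding continuous_on_sequentially
proof (intro allI ballI impI)
  fix X x assume x: "x \<in> ball x0 (r/2)" and X: "(\<forall>n. X n \<in> ball x0 (r/2)) \<and> X \<longlonglongrightarrow> x"
  have "(\<lambda>n. potential (X n)) \<longlonglongrightarrow> potential x"
    unfolding potential_def
  proof (rule integral_dominated_convergence[OF _ _ integrable_majorant])
    have "(\<lambda>n. v y * norm (X n - y) powr - (DIM('a) + 2 * s))
       \<longlonglongrightarrow> v y * norm (x - y) powr - (DIM('a) + 2 * s)" for y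
    proof (cases "y \<in> ball x0 r")
      case False
      then have "x \<noteq> y" using x r by auto
      then show ?thesis using X by (intro tendsto_intros) auto
    qed (simp add: zero)
    then show "AE y in lborel. (\<lambda>n. v y * norm (X n - y) powr - (DIM('a) + 2 * s))
       \<longlonglongrightarrow> v y * norm (x - y) powr - (DIM('a) + 2 * s)" by simp
    show "AE y in lborel. norm (v y * norm (X n - y) powr - (DIM('a) + 2 * s)) \<le> majorant y" for n
      using potential_dominated[of "X n"] X by (simp add: abs_mult)
  qed measurable
  then show "(potential \<circ> X) \<longlonglongrightarrow> potential x" by (simp add: comp_def)
qed

text \<open>The product of v and \<phi> is 0, so only - (\<phi> x * v y + \<phi> y * v x) remains of
  the numerator. The two halves agree under exchange of x and y, which cancels the 1/2 in the form,
  and Fubini integrates out y.\<close>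

lemma frac_form_eq_potential:
  assumes \<phi>: "test_fun (ball x0 (r/2)) \<phi>"
  shows "frac_form s v \<phi> = - frac_const DIM('a) s * (\<integral>x. potential x * \<phi> x \<partial>lborel)"
proof -
  obtain M where M: "0 \<le> M" "\<And>x. \<bar>\<phi> x\<bar> \<le> M" using test_fun_bounded[OF \<phi>] by blast
  have [measurable]: "\<phi> \<in> borel_measurable borel"
    by (rule borel_measurable_continuous_onI[OF test_fun_continuous[OF \<phi>]])
  define Q where "Q p = \<phi> (fst p) * (v (snd p) * norm (fst p - snd p) powr - (DIM('a) + 2 * s))" for p
  have Q: "integrable (lborel \<Otimes>\<^sub>M lborel) Q"
  proof (rule Bochner_Integration.integrable_bound)
    show "integrable (lborel \<Otimes>\<^sub>M lborel) (\<lambda>p. (M * indicator (ball x0 (r/2)) (fst p)) * majorant (snd p))"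
      using emeasure_lborel_ball_finite[of x0 "r/2"]
      by (intro integrable_pair_product integrable_majorant integrable_mult_right integrable_real_indicator) auto
    show "Q \<in> borel_measurable (lborel \<Otimes>\<^sub>M lborel)" unfolding Q_def[abs_def] by measurable
    have le: "\<bar>Q (x, y)\<bar> \<le> (M * indicator (ball x0 (r/2)) x) * majorant y" for x y
    proof (cases "x \<in> ball x0 (r/2)")
      case True
      then show ?thesis using M potential_dominated[OF True, of y]
        unfolding Q_def abs_mult by (auto intro!: mult_mono)
    next
      case False
      then show ?thesis using test_fun_zero[OF \<phi> False] by (simp add: Q_def)
    qed
    show "AE p in lborel \<Otimes>\<^sub>M lborel. norm (Q p) \<le> norm ((M * indicator (ball x0 (r/2)) (fst p)) * majorant (snd p))"
    proof (rule AE_I2)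
      fix p
      show "norm (Q p) \<le> norm ((M * indicator (ball x0 (r/2)) (fst p)) * majorant (snd p))"
        using order_trans[OF le[of "fst p" "snd p"] abs_ge_self] by (simp only: real_norm_def prod.collapse)
    qed
  qed
  have Q': "integrable (lborel \<Otimes>\<^sub>M lborel) (\<lambda>p. Q (snd p, fst p))"
    using lborel_pair.integrable_product_swap[OF Q] by (simp add: case_prod_unfold)
  have swap: "(\<integral>p. Q (snd p, fst p) \<partial>(lborel \<Otimes>\<^sub>M lborel)) = (\<integral>p. Q p \<partial>(lborel \<Otimes>\<^sub>M lborel))"
    using lborel_pair.integral_product_swap[of Q] Q by (simp add: case_prod_unfold)
  have v\<phi>: "v x * \<phi> x = 0" for x
    using zero[of x] test_fun_zero[OF \<phi>, of x] r by (cases "x \<in> ball x0 r") auto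
  have "form_integrand s v \<phi> p = - (Q p + Q (snd p, fst p))" for p
  proof -
    obtain x y where p: "p = (x, y)" by fastforce
    have "(v x - v y) * (\<phi> x - \<phi> y) = - (\<phi> x * v y + \<phi> y * v x)"
      using v\<phi>[of x] v\<phi>[of y] by algebra
    then have "form_integrand s v \<phi> p = - (\<phi> x * v y + \<phi> y * v x) * norm (x - y) powr - (DIM('a) + 2 * s)"
      unfolding form_integrand_def p powr_minus_divide by (simp add: dist_norm)
    then show ?thesis by (simp add: p Q_def norm_minus_commute[of y x] algebra_simps)
  qed
  then have "(\<integral>p. form_integrand s v \<phi> p \<partial>(lborel \<Otimes>\<^sub>M lborel)) = - 2 * (\<integral>p. Q p \<partial>(lborel \<Otimes>\<^sub>M lborel))"
    using Q Q' swap by simp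
  also have "(\<integral>p. Q p \<partial>(lborel \<Otimes>\<^sub>M lborel)) = (\<integral>x. \<integral>y. Q (x, y) \<partial>lborel \<partial>lborel)"
    by (rule lborel_pair.integral_fst'[OF Q, symmetric])
  also have "(\<integral>x. \<integral>y. Q (x, y) \<partial>lborel \<partial>lborel) = (\<integral>x. potential x * \<phi> x \<partial>lborel)"
    by (simp add: Q_def potential_def mult.commute)
  finally show ?thesis by (simp add: frac_form_eq)
qed

lemma weak_unique_continuation_bounded:
  assumes weak: "\<And>\<phi>. test_fun (ball x0 r) \<phi> \<Longrightarrow> frac_form s v \<phi> = 0"
  shows "v y = 0"
proof -
  \<comment> \<open>The potential is controlled only on the half ball, whereas
    \<open>fundamental_lemma_borel\<close> asks for a bound on the whole space.\<close>
  define g where "g x = indicator (ball x0 (r/2)) x * potential x" for x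
  have "AE x in lborel. x \<in> ball x0 (r/2) \<longrightarrow> g x = 0"
  proof (rule fundamental_lemma_borel[where B = "\<integral>y. majorant y \<partial>lborel"])
    show "g \<in> borel_measurable borel" unfolding g_def[abs_def]
      by (intro borel_measurable_times borel_measurable_indicator potential_measurable) simp
    have "0 \<le> (\<integral>y. majorant y \<partial>lborel)"
      using order_trans[OF abs_ge_zero potential_bound[of x0]] r by simp
    then show "\<bar>g x\<bar> \<le> (\<integral>y. majorant y \<partial>lborel)" for x
      using potential_bound[of x] by (auto simp: g_def indicator_def)
    fix \<phi> assume \<phi>: "test_fun (ball x0 (r/2)) \<phi>"
    have "frac_form s v \<phi> = 0" by (rule weak, rule test_fun_mono[OF \<phi>]) (use r in auto)
    then have "(\<integral>x. potential x * \<phi> x \<partial>lborel) = 0"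
      using frac_form_eq_potential[OF \<phi>] frac_const_pos[OF s, of "DIM('a)"] by simp
    moreover have "(\<lambda>x. g x * \<phi> x) = (\<lambda>x. potential x * \<phi> x)"
    proof (rule ext)
      show "g x * \<phi> x = potential x * \<phi> x" for x
        using test_fun_zero[OF \<phi>, of x] by (cases "x \<in> ball x0 (r/2)") (simp_all add: g_def)
    qed
    ultimately show "(\<integral>x. g x * \<phi> x \<partial>lborel) = 0" by simp
  qed simp
  then have "AE x in lborel. x \<in> ball x0 (r/2) \<longrightarrow> potential x = 0"
    by eventually_elim (simp add: g_def)
  then have "AE x in lebesgue. x \<in> ball x0 (r/2) \<longrightarrow> potential x = 0" by (rule AE_completion)
  then have "potential x = 0" if "x \<in> ball x0 (r/2)" for x
    using continuous_AE_eq_0_imp_eq_0[OF open_ball potential_continuous] that by blast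
  then show ?thesis
    using potential_zero_imp_zero[of "r/2" "2 * s" v x0 B y] s r cont zero bound
    by (simp add: potential_def)
qed

end

lemma weak_unique_continuation:
  fixes v :: "'a::euclidean_space \<Rightarrow> real"
  assumes "0 < s" "s < 1" "holder_on UNIV s v" "0 < r" "\<And>y. y \<in> ball x0 r \<Longrightarrow> v y = 0"
    and "\<And>\<phi>. test_fun (ball x0 r) \<phi> \<Longrightarrow> frac_form s v \<phi> = 0"
  shows "v y = 0"
proof -
  obtain B where "continuous_on UNIV v" "\<And>x. \<bar>v x\<bar> \<le> B"
    using assms(3) unfolding holder_on_def bounded_iff by auto
  then show ?thesis using weak_unique_continuation_bounded[OF assms(1,2,4)] assms(5,6) by blast
qed

section \<open>The inverse problem\<close>

text \<open>Intersecting V with one dense open set leaves a nonempty open set for the next one, so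
  no Baire argument is involved. In use there is one set for each pair of solutions.\<close>

lemma ex_point_in_finitely_many_dense_open:
  assumes "finite P" "\<And>p. p \<in> P \<Longrightarrow> open (D p)"
    and "\<And>p V. p \<in> P \<Longrightarrow> open V \<Longrightarrow> V \<noteq> {} \<Longrightarrow> V \<subseteq> \<Omega> \<Longrightarrow> V \<inter> D p \<noteq> {}"
    and "open V" "V \<noteq> {}" "V \<subseteq> \<Omega>"
  shows "\<exists>y\<in>V. \<forall>p\<in>P. y \<in> D p"
  using assms
proof (induction P arbitrary: V rule: finite_induct)
  case (insert p P)
  have "open (V \<inter> D p)" "V \<inter> D p \<noteq> {}" "V \<inter> D p \<subseteq> \<Omega>"
    using insert.prems by auto
  then have "\<exists>y\<in>V \<inter> D p. \<forall>q\<in>P. y \<in> D q"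
    using insert.prems by (intro insert.IH) auto
  then show ?case by blast
qed blast

text \<open>Moving c to the left makes it the constant term of a polynomial of degree at most N with
  N + 1 distinct roots. As m >= 1, a nonzero b m survives in this polynomial and contradicts the
  root bound.\<close>

lemma coeff_eq_0_if_many_roots:
  fixes b t :: "nat \<Rightarrow> real"
  assumes inj: "inj_on t {..N}" and eq: "\<And>k. k \<le> N \<Longrightarrow> (\<Sum>m=1..N. b m * t k ^ m) = c"
    and m: "m \<in> {1..N}"
  shows "b m = 0"
proof (rule ccontr)
  assume nz: "b m \<noteq> 0"
  define d where "d i = (if i = 0 then - c else b i)" for i
  have "(\<Sum>i\<le>N. d i * z ^ i) = (\<Sum>m=1..N. b m * z ^ m) - c" for z
    by (simp add: d_def atMost_atLeast0 sum.atLeast_Suc_atMost)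
  then have sub: "t ` {..N} \<subseteq> {z. (\<Sum>i\<le>N. d i * z ^ i) = 0}" using eq by auto
  have "finite {z. (\<Sum>i\<le>N. d i * z ^ i) = 0} \<and> card {z. (\<Sum>i\<le>N. d i * z ^ i) = 0} \<le> N"
    using Transcendental.polyfun_rootbound[of d m N] nz m by (simp add: d_def)
  then have "card (t ` {..N}) \<le> N" using card_mono[OF _ sub] by linarith
  then show False using card_image[OF inj] by simp
qed

lemma integrable_mult_test_fun:
  fixes h \<phi> :: "'a::euclidean_space \<Rightarrow> real"
  assumes h: "h \<in> borel_measurable lebesgue" and B: "AE x in lebesgue. \<bar>h x\<bar> \<le> B" and \<phi>: "test_fun \<Omega> \<phi>"
  shows "integrable lebesgue (\<lambda>x. h x * \<phi> x)"
proof -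
  obtain M where M: "0 \<le> M" "\<And>x. \<bar>\<phi> x\<bar> \<le> M" using test_fun_bounded[OF \<phi>] by blast
  define S where "S = closure {x. \<phi> x \<noteq> 0}"
  have S: "compact S" using \<phi> unfolding test_fun_def S_def by blast
  have out: "\<phi> x = 0" if "x \<notin> S" for x
    using that closure_subset[of "{x. \<phi> x \<noteq> 0}"] unfolding S_def by blast
  have \<phi>m: "\<phi> \<in> borel_measurable lebesgue"
    using borel_measurable_continuous_onI[OF test_fun_continuous[OF \<phi>]] by (simp add: measurable_completion)
  show ?thesis
  proof (rule Bochner_Integration.integrable_bound)
    show "integrable lebesgue (\<lambda>x. \<bar>B\<bar> * M * indicator S x)"
      using lmeasurable_compact[OF S] by (intro integrable_mult_right integrable_real_indicator) (auto simp: fmeasurable_def)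
    show "(\<lambda>x. h x * \<phi> x) \<in> borel_measurable lebesgue"
      by (rule borel_measurable_times[OF h \<phi>m])
    show "AE x in lebesgue. norm (h x * \<phi> x) \<le> norm (\<bar>B\<bar> * M * indicator S x)"
      using B
    proof eventually_elim
      case (elim x)
      show ?case
      proof (cases "x \<in> S")
        case True
        have "\<bar>h x\<bar> * \<bar>\<phi> x\<bar> \<le> \<bar>B\<bar> * M" using elim M(2)[of x] by (intro mult_mono) auto
        then show ?thesis using True M by (simp add: abs_mult)
      qed (simp add: out)
    qed
  qed
qed

lemma indicator_mult_measurable_bounded:
  fixes g :: "'a::euclidean_space \<Rightarrow> real"
  assumes "open \<Omega>" "bounded \<Omega>" "continuous_on (closure \<Omega>) g"
  shows "(\<lambda>x. indicator \<Omega> x * g x) \<in> borel_measurable lebesgue"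
    and "\<exists>B. AE x in lebesgue. \<bar>indicator \<Omega> x * g x\<bar> \<le> B"
proof -
  have "(\<lambda>x. indicator \<Omega> x *\<^sub>R g x) \<in> borel_measurable borel"
    using assms(1) continuous_on_subset[OF assms(3) closure_subset]
    by (intro borel_measurable_continuous_on_indicator) auto
  then show "(\<lambda>x. indicator \<Omega> x * g x) \<in> borel_measurable lebesgue"
    by (simp add: measurable_completion)
  have "bounded (g ` closure \<Omega>)"
    using assms by (intro compact_imp_bounded compact_continuous_image) (auto simp: compact_closure)
  then obtain B where B: "\<And>x. x \<in> closure \<Omega> \<Longrightarrow> \<bar>g x\<bar> \<le> B" unfolding bounded_iff by auto
  have "\<bar>indicator \<Omega> x * g x\<bar> \<le> \<bar>B\<bar>" for x
    using B[of x] closure_subset[of \<Omega>] by (cases "x \<in> \<Omega>") auto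
  then show "\<exists>B. AE x in lebesgue. \<bar>indicator \<Omega> x * g x\<bar> \<le> B" by blast
qed

text \<open>The comparison takes place outside \<Omega>: in \<open>W2\<close> both solutions equal
  the C^2 datum f, so equal fractional Laplacians mean that the potential of u1 - u2 vanishes.
  Equations with different nonlinearities thus share one solution, which is what permits subtracting
  them.\<close>

lemma solutions_coincide:
  fixes u1 u2 f :: "'a::euclidean_space \<Rightarrow> real"
  assumes s: "0 < s" "s < 1" and W2: "open W2" "W2 \<noteq> {}" "W2 \<subseteq> - closure \<Omega>"
    and f: "C2s_on (- closure \<Omega>) s' f"
    and sol: "frac_solution \<Omega> s A1 F1 f u1" "frac_solution \<Omega> s A2 F2 f u2"
    and eq: "\<And>x. x \<in> W2 \<Longrightarrow> frac_lap s u1 x = frac_lap s u2 x"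
  shows "u1 = u2"
proof -
  have ext: "u1 x = f x" "u2 x = f x" if "x \<in> - closure \<Omega>" for x
    using sol that unfolding frac_solution_def by blast+
  have holder: "holder_on UNIV s u1" "holder_on UNIV s u2"
    using sol unfolding frac_solution_def by blast+
  then have cont: "continuous_on UNIV u1" "continuous_on UNIV u2"
    unfolding holder_on_def by blast+
  obtain B1 B2 where "\<And>x. \<bar>u1 x\<bar> \<le> B1" "\<And>x. \<bar>u2 x\<bar> \<le> B2"
    using holder unfolding holder_on_def bounded_iff by auto
  then have B: "\<bar>u1 x\<bar> \<le> max B1 B2" "\<bar>u2 x\<bar> \<le> max B1 B2" for x
    by (simp_all add: le_max_iff_disj)
  obtain x0 where "x0 \<in> W2" using W2 by blast
  then obtain r where r: "0 < r" "ball x0 r \<subseteq> W2" using W2(1) open_contains_ball by blast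
  have "u1 y - u2 y = 0" for y
  proof (rule potential_zero_imp_zero[of r "2 * s" "\<lambda>y. u1 y - u2 y" x0 "2 * max B1 B2"])
    show "continuous_on UNIV (\<lambda>y. u1 y - u2 y)" using cont by (intro continuous_intros)
    show "u1 y - u2 y = 0" if "y \<in> ball x0 r" for y
    proof -
      have "y \<in> - closure \<Omega>" using that r W2(3) by blast
      then show ?thesis using ext by simp
    qed
    show "\<bar>u1 y - u2 y\<bar> \<le> 2 * max B1 B2" for y using B[of y] by linarith
    show "(\<integral>y. (u1 y - u2 y) * norm (x - y) powr - (real DIM('a) + 2 * s) \<partial>lborel) = 0"
      if "x \<in> ball x0 r" for x
      by (rule frac_lap_eq_imp_potential_eq_0[OF s cont B _ _ ext f])
         (use that r W2 eq in auto)
  qed (use s r in auto)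
  then show ?thesis by auto
qed

text \<open>If u = v on a ball in \<Omega>, the nonlinear terms agree there whatever A is, so the
  weak equations give u - v a vanishing form against test functions in the ball. Unique continuation
  carries u = v to the exterior point x, where f and g differ.\<close>

lemma solutions_differ_densely:
  fixes u v f g :: "'a::euclidean_space \<Rightarrow> real"
  assumes s: "0 < s" "s < 1"
    and sol: "frac_solution \<Omega> s A F f u" "frac_solution \<Omega> s A F g v"
    and x: "x \<in> - closure \<Omega>" "f x \<noteq> g x"
    and V: "open V" "V \<noteq> {}" "V \<subseteq> \<Omega>"
  shows "V \<inter> {y. u y \<noteq> v y} \<noteq> {}"
proof
  assume eq: "V \<inter> {y. u y \<noteq> v y} = {}"
  have holder: "holder_on UNIV s u" "holder_on UNIV s v"
    using sol unfolding frac_solution_def by blast+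
  obtain x0 where "x0 \<in> V" using V by blast
  then obtain r where r: "0 < r" "ball x0 r \<subseteq> V" using V(1) open_contains_ball by blast
  have "u x - v x = 0"
  proof (rule weak_unique_continuation[OF s holder_on_diff[OF holder] r(1)])
    show "u y - v y = 0" if "y \<in> ball x0 r" for y using eq that r by auto
    fix \<phi> assume \<phi>: "test_fun (ball x0 r) \<phi>"
    have \<phi>\<Omega>: "test_fun \<Omega> \<phi>" by (rule test_fun_mono[OF \<phi>]) (use r V in auto)
    have "u y = v y" if "y \<in> ball x0 r" for y using eq that r by auto
    then have "indicator \<Omega> y * A y (u y) * \<phi> y = indicator \<Omega> y * A y (v y) * \<phi> y" for y
      using test_fun_zero[OF \<phi>, of y] by (cases "y \<in> ball x0 r") auto
    then have "(\<integral>y. indicator \<Omega> y * A y (u y) * \<phi> y \<partial>lebesgue) = (\<integral>y. indicator \<Omega> y * A y (v y) * \<phi> y \<partial>lebesgue)"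
      by (intro Bochner_Integration.integral_cong) auto
    moreover have "frac_form s u \<phi> + (\<integral>x. indicator \<Omega> x * A x (u x) * \<phi> x \<partial>lebesgue) = (\<integral>x. indicator \<Omega> x * F x * \<phi> x \<partial>lebesgue)"
      "frac_form s v \<phi> + (\<integral>x. indicator \<Omega> x * A x (v x) * \<phi> x \<partial>lebesgue) = (\<integral>x. indicator \<Omega> x * F x * \<phi> x \<partial>lebesgue)"
      using sol \<phi>\<Omega> unfolding frac_solution_def by blast+
    ultimately show "frac_form s (\<lambda>x. u x - v x) \<phi> = 0"
      using frac_form_diff[OF s holder \<phi>\<Omega>] by simp
  qed
  then show False using x sol unfolding frac_solution_def by auto
qed

text \<open>Both equations contain the same \<open>frac_form s u \<phi>\<close>, which cancels; the
  fundamental lemma turns the remaining integral identity into an almost everywhere one.\<close>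

lemma common_solution_AE:
  fixes u f :: "'a::euclidean_space \<Rightarrow> real"
  assumes \<Omega>: "open \<Omega>" "bounded \<Omega>"
    and sol: "frac_solution \<Omega> s A1 F1 f u" "frac_solution \<Omega> s A2 F2 f u"
    and A: "continuous_on (closure \<Omega>) (\<lambda>x. A1 x (u x))" "continuous_on (closure \<Omega>) (\<lambda>x. A2 x (u x))"
    and F1: "set_borel_measurable lebesgue \<Omega> F1" "\<exists>B. AE x in lebesgue. x \<in> \<Omega> \<longrightarrow> \<bar>F1 x\<bar> \<le> B"
    and F2: "set_borel_measurable lebesgue \<Omega> F2" "\<exists>B. AE x in lebesgue. x \<in> \<Omega> \<longrightarrow> \<bar>F2 x\<bar> \<le> B"
  shows "AE x in lebesgue. x \<in> \<Omega> \<longrightarrow> A1 x (u x) - A2 x (u x) = F1 x - F2 x"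
proof -
  define h where "h H x = indicator \<Omega> x * H x" for H :: "'a \<Rightarrow> real" and x
  have hF: "h F \<in> borel_measurable lebesgue" "\<exists>B. AE x in lebesgue. \<bar>h F x\<bar> \<le> B"
    if F: "set_borel_measurable lebesgue \<Omega> F" "\<exists>B. AE x in lebesgue. x \<in> \<Omega> \<longrightarrow> \<bar>F x\<bar> \<le> B" for F
  proof -
    show "h F \<in> borel_measurable lebesgue"
      using F(1) by (simp add: set_borel_measurable_def h_def[abs_def])
    obtain B where "AE x in lebesgue. x \<in> \<Omega> \<longrightarrow> \<bar>F x\<bar> \<le> B" using F(2) by blast
    then have "AE x in lebesgue. \<bar>h F x\<bar> \<le> \<bar>B\<bar>" by eventually_elim (auto simp: h_def indicator_def)
    then show "\<exists>B. AE x in lebesgue. \<bar>h F x\<bar> \<le> B" by blast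
  qed
  let ?H = "{\<lambda>x. A1 x (u x), \<lambda>x. A2 x (u x), F1, F2}"
  have hA: "h H \<in> borel_measurable lebesgue" "\<exists>B. AE x in lebesgue. \<bar>h H x\<bar> \<le> B"
    if "continuous_on (closure \<Omega>) H" for H
    using indicator_mult_measurable_bounded[OF \<Omega> that] unfolding h_def[abs_def] .
  have meas: "h H \<in> borel_measurable lebesgue" if "H \<in> ?H" for H
    using that hF(1)[OF F1] hF(1)[OF F2] hA(1)[OF A(1)] hA(1)[OF A(2)] by blast
  have bdd: "\<exists>B. AE x in lebesgue. \<bar>h H x\<bar> \<le> B" if "H \<in> ?H" for H
    using that hF(2)[OF F1] hF(2)[OF F2] hA(2)[OF A(1)] hA(2)[OF A(2)] by blast
  define g where "g x = h (\<lambda>x. A1 x (u x)) x - h (\<lambda>x. A2 x (u x)) x - (h F1 x - h F2 x)" for x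
  obtain B1 B2 B3 B4 where B: "AE x in lebesgue. \<bar>h (\<lambda>x. A1 x (u x)) x\<bar> \<le> B1"
    "AE x in lebesgue. \<bar>h (\<lambda>x. A2 x (u x)) x\<bar> \<le> B2"
    "AE x in lebesgue. \<bar>h F1 x\<bar> \<le> B3" "AE x in lebesgue. \<bar>h F2 x\<bar> \<le> B4"
    using bdd[of "\<lambda>x. A1 x (u x)"] bdd[of "\<lambda>x. A2 x (u x)"] bdd[of F1] bdd[of F2] by blast
  have "AE x in lebesgue. x \<in> \<Omega> \<longrightarrow> g x = 0"
  proof (rule fundamental_lemma[OF \<Omega>(1), where B = "B1 + B2 + B3 + B4"])
    show "g \<in> borel_measurable lebesgue"
      unfolding g_def[abs_def] by (intro borel_measurable_diff meas) auto
    show "AE x in lebesgue. \<bar>g x\<bar> \<le> B1 + B2 + B3 + B4"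
      using B by eventually_elim (simp add: g_def)
    fix \<phi> assume \<phi>: "test_fun \<Omega> \<phi>"
    have int: "integrable lebesgue (\<lambda>x. h H x * \<phi> x)" if "H \<in> ?H" for H
      using integrable_mult_test_fun[OF meas[OF that] _ \<phi>] bdd[OF that] by blast
    have "frac_form s u \<phi> + (\<integral>x. h (\<lambda>x. A1 x (u x)) x * \<phi> x \<partial>lebesgue) = (\<integral>x. h F1 x * \<phi> x \<partial>lebesgue)"
      "frac_form s u \<phi> + (\<integral>x. h (\<lambda>x. A2 x (u x)) x * \<phi> x \<partial>lebesgue) = (\<integral>x. h F2 x * \<phi> x \<partial>lebesgue)"
      using sol \<phi> unfolding frac_solution_def h_def by blast+
    moreover have "(\<integral>x. g x * \<phi> x \<partial>lebesgue)
      = (\<integral>x. h (\<lambda>x. A1 x (u x)) x * \<phi> x \<partial>lebesgue) - (\<integral>x. h (\<lambda>x. A2 x (u x)) x * \<phi> x \<partial>lebesgue)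
        - ((\<integral>x. h F1 x * \<phi> x \<partial>lebesgue) - (\<integral>x. h F2 x * \<phi> x \<partial>lebesgue))"
      using int by (simp add: g_def left_diff_distrib)
    ultimately show "(\<integral>x. g x * \<phi> x \<partial>lebesgue) = 0" by linarith
  qed
  then show ?thesis by eventually_elim (simp add: g_def h_def)
qed

theorem theorem1p1:
  fixes \<Omega> W1 W2 :: "'a::euclidean_space set" and s :: real and N :: nat
    and a1 a2 :: "nat \<Rightarrow> 'a \<Rightarrow> real" and F1 F2 :: "'a \<Rightarrow> real"
    and f :: "nat \<Rightarrow> 'a \<Rightarrow> real"
  assumes dom: "open \<Omega>" "connected \<Omega>" "bounded \<Omega>" "\<Omega> \<noteq> {}"
    and bdry: "C11_boundary \<Omega>"
    and s: "0 < s" "s < 1"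
    and W1: "open W1" "W1 \<noteq> {}" "W1 \<subseteq> - closure \<Omega>"
    and W2: "open W2" "W2 \<noteq> {}" "W2 \<subseteq> - closure \<Omega>"
    and N: "1 \<le> N"
    and a1: "\<forall>k\<in>{1..N}. holder_on (closure \<Omega>) s (a1 k)"
    and a2: "\<forall>k\<in>{1..N}. holder_on (closure \<Omega>) s (a2 k)"
    and F1: "set_borel_measurable lebesgue \<Omega> F1" "\<exists>B. AE x in lebesgue. x \<in> \<Omega> \<longrightarrow> \<bar>F1 x\<bar> \<le> B"
    and F2: "set_borel_measurable lebesgue \<Omega> F2" "\<exists>B. AE x in lebesgue. x \<in> \<Omega> \<longrightarrow> \<bar>F2 x\<bar> \<le> B"
    and f_reg: "\<forall>k\<le>N. C2s_on (- closure \<Omega>) s (f k) \<and> C2s_on W1 s (f k)"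
    and f_supp: "\<forall>k\<le>N. (- closure \<Omega>) \<inter> closure {x \<in> - closure \<Omega>. f k x \<noteq> 0} \<subseteq> W1"
    and f_dist: "\<forall>k\<le>N. \<forall>l\<le>N. k \<noteq> l \<longrightarrow> (\<exists>x\<in>W1. f k x \<noteq> f l x)"
    and wp1: "\<forall>k\<le>N. \<exists>!u. frac_solution \<Omega> s (\<lambda>x v. \<Sum>m=1..N. a1 m x * v ^ m) F1 (f k) u"
    and wp2: "\<forall>k\<le>N. \<exists>!u. frac_solution \<Omega> s (\<lambda>x v. \<Sum>m=1..N. a2 m x * v ^ m) F2 (f k) u"
    and cauchy: "\<forall>k\<le>N. \<forall>u1 u2.
        frac_solution \<Omega> s (\<lambda>x v. \<Sum>m=1..N. a1 m x * v ^ m) F1 (f k) u1 \<longrightarrow>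
        frac_solution \<Omega> s (\<lambda>x v. \<Sum>m=1..N. a2 m x * v ^ m) F2 (f k) u2 \<longrightarrow>
        (\<forall>x\<in>W1. u1 x = u2 x) \<and> (\<forall>x\<in>W2. frac_lap s u1 x = frac_lap s u2 x)"
  shows "(\<forall>k\<in>{1..N}. \<forall>x\<in>\<Omega>. a1 k x = a2 k x) \<and> (AE x in lebesgue. x \<in> \<Omega> \<longrightarrow> F1 x = F2 x)"
proof -
  let ?A1 = "\<lambda>x v. \<Sum>m=1..N. a1 m x * v ^ m" and ?A2 = "\<lambda>x v. \<Sum>m=1..N. a2 m x * v ^ m"
  have "\<exists>u. frac_solution \<Omega> s ?A1 F1 (f k) u \<and> frac_solution \<Omega> s ?A2 F2 (f k) u" if k: "k \<le> N" for k
  proof -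
    obtain u1 u2 where sol: "frac_solution \<Omega> s ?A1 F1 (f k) u1" "frac_solution \<Omega> s ?A2 F2 (f k) u2"
      using wp1 wp2 k by blast
    have "u1 = u2"
    proof (rule solutions_coincide[OF s W2 _ sol])
      show "C2s_on (- closure \<Omega>) s (f k)" using f_reg k by blast
      show "frac_lap s u1 x = frac_lap s u2 x" if "x \<in> W2" for x
        using cauchy[rule_format, OF k sol] that by blast
    qed
    then show ?thesis using sol by blast
  qed
  then have "\<forall>k. \<exists>u. k \<le> N \<longrightarrow> frac_solution \<Omega> s ?A1 F1 (f k) u \<and> frac_solution \<Omega> s ?A2 F2 (f k) u"
    by blast
  from choice[OF this] obtain u where
    u: "\<forall>k. k \<le> N \<longrightarrow> frac_solution \<Omega> s ?A1 F1 (f k) (u k) \<and> frac_solution \<Omega> s ?A2 F2 (f k) (u k)" ..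
  have u1: "frac_solution \<Omega> s ?A1 F1 (f k) (u k)" and u2: "frac_solution \<Omega> s ?A2 F2 (f k) (u k)"
    if "k \<le> N" for k
    using u that by auto
  have cont_u: "continuous_on S (u k)" if "k \<le> N" for k S
    by (rule continuous_on_subset[OF _ subset_UNIV])
       (use u1[OF that] in \<open>simp add: frac_solution_def holder_on_def\<close>)
  have cont_a: "continuous_on (closure \<Omega>) (a1 m)" "continuous_on (closure \<Omega>) (a2 m)" if "m \<in> {1..N}" for m
    using a1 a2 that unfolding holder_on_def by blast+
  define b where "b m x = a1 m x - a2 m x" for m x
  have cont_b: "continuous_on \<Omega> (b m)" if "m \<in> {1..N}" for m
    unfolding b_def
    by (intro continuous_on_diff cont_a[OF that, THEN continuous_on_subset] closure_subset)
  define P where "P k x = (\<Sum>m=1..N. b m x * u k x ^ m)" for k x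
  have ae: "AE x in lebesgue. x \<in> \<Omega> \<longrightarrow> P k x = F1 x - F2 x" if k: "k \<le> N" for k
  proof -
    have "AE x in lebesgue. x \<in> \<Omega> \<longrightarrow> ?A1 x (u k x) - ?A2 x (u k x) = F1 x - F2 x"
      by (rule common_solution_AE[OF dom(1,3) u1[OF k] u2[OF k] _ _ F1 F2])
         (intro continuous_intros cont_a cont_u k; simp)+
    then show ?thesis by (simp add: P_def b_def left_diff_distrib sum_subtractf)
  qed
  \<comment> \<open>F1 - F2 is known only up to null sets and cannot be evaluated at a chosen point.
    Comparing P k with P 0 eliminates it and leaves continuous functions, whose identity holds at
    every point of \<Omega>.\<close>
  have P_eq: "P k x = P 0 x" if k: "k \<le> N" and x: "x \<in> \<Omega>" for k x
  proof -
    have "continuous_on \<Omega> (\<lambda>x. P k x - P 0 x)"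
      unfolding P_def by (intro continuous_intros cont_b cont_u) (use k in auto)
    moreover have "AE x in lebesgue. x \<in> \<Omega> \<longrightarrow> P k x - P 0 x = 0"
      using ae[OF k] ae[OF le0] by eventually_elim auto
    ultimately show ?thesis using continuous_AE_eq_0_imp_eq_0[OF dom(1)] x by fastforce
  qed
  have b0: "b m x = 0" if m: "m \<in> {1..N}" and x: "x \<in> \<Omega>" for m x
  proof (rule ccontr)
    assume nz: "b m x \<noteq> 0"
    \<comment> \<open>Some solutions may coincide at x itself. Since b m stays nonzero on the open
      set V, the point can be moved inside V to one where all N + 1 values are distinct.\<close>
    define V where "V = \<Omega> \<inter> b m -` (- {0})"
    have V: "open V" "V \<noteq> {}" "V \<subseteq> \<Omega>"
      using continuous_open_preimage[OF cont_b[OF m] dom(1), of "- {0}"] nz x by (auto simp: V_def)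
    have "\<exists>y\<in>V. \<forall>p\<in>{(k, l). k \<le> N \<and> l \<le> N \<and> k \<noteq> l}. y \<in> {y. u (fst p) y \<noteq> u (snd p) y}"
    proof (rule ex_point_in_finitely_many_dense_open[OF _ _ _ V])
      show "finite {(k, l). k \<le> N \<and> l \<le> N \<and> k \<noteq> l}"
        by (rule finite_subset[of _ "{..N} \<times> {..N}"]) auto
      fix p assume p: "p \<in> {(k, l). k \<le> N \<and> l \<le> N \<and> k \<noteq> l}"
      show "open {y. u (fst p) y \<noteq> u (snd p) y}"
        using p by (intro open_Collect_neq cont_u) auto
      fix V assume V: "open V" "V \<noteq> {}" "V \<subseteq> \<Omega>"
      obtain x where "x \<in> W1" "f (fst p) x \<noteq> f (snd p) x" using f_dist p by force
      then show "V \<inter> {y. u (fst p) y \<noteq> u (snd p) y} \<noteq> {}"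
        by (intro solutions_differ_densely[OF s u1 u1 _ _ V]) (use p W1 in auto)
    qed
    then obtain y where y: "y \<in> V" "\<And>k l. k \<le> N \<Longrightarrow> l \<le> N \<Longrightarrow> k \<noteq> l \<Longrightarrow> u k y \<noteq> u l y"
      by force
    have "b m y = 0"
    proof (rule coeff_eq_0_if_many_roots[OF _ _ m])
      show "inj_on (\<lambda>k. u k y) {..N}" using y(2) by (auto simp: inj_on_def)
      \<comment> \<open>P 0 y serves as the common value c, the same for all k; it stands in for F1
        - F2 at y.\<close>
      show "(\<Sum>m = 1..N. b m y * u k y ^ m) = P 0 y" if "k \<le> N" for k
        using P_eq[OF that, of y] y(1) V(3) by (auto simp: P_def)
    qed
    then show False using y(1) by (simp add: V_def)
  qed
  have "AE x in lebesgue. x \<in> \<Omega> \<longrightarrow> F1 x = F2 x"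
    using ae[OF le0] by eventually_elim (auto simp: P_def b0)
  then show ?thesis using b0 by (auto simp: b_def)
qed

end
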